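(* For every prime power $q$ there is a constant $C_q$, and there is an absolute constant $c$, such that the following holds. Let $0<\varepsilon<1$, and let $\Phi$ be an instance of CSP$(\mathcal{P})$, where $\mathcal{P}$ is the set of all affine predicates over $\mathbb{F}_q$ (of any arities, which may differ between constraints and may be as large as the number of variables), on $k$ variables $x_1,\dots,x_k$ taking values in $\mathbb{F}_q$, with constraints $C_1,\dots,C_m$. Then $\Phi$ has a $(1\pm\varepsilon)$-sparsifier using at most $C_q\frac{k}{\varepsilon^2}(\log_2(4k/\varepsilon))^{c}$ constraints.
   Context: A predicate $P:\mathbb{F}_q^r\to\{0,1\}$ is affine if there exist $a_0,a_1,\dots,a_r\in\mathbb{F}_q$ such that $P(b_1,\dots,b_r)=0$ if and only if $a_0+\sum_{i=1}^r a_i b_i = 0$ in $\mathbb{F}_q$. An instance of CSP$(\mathcal{P})$ on variables $x_1,\dots,x_k$ is a list of constraints $C_j = P^{(j)}(x_{j,1},\dots,x_{j,r_j})$ with $P^{(j)}\in\mathcal{P}$ of arity $r_j$ applied to a tuple of the variables. For an assignment $x\in\mathbb{F}_q^k$, its value is $\sum_{j=1}^m C_j(x)$. A $(1\pm\varepsilon)$-sparsifier is a subset $T\subseteq[m]$ with nonnegative weights $(w_j)_{j\in T}$ such that for every assignment $x\in\mathbb{F}_q^k$: $(1-\varepsilon)\sum_{j=1}^m C_j(x)\le\sum_{j\in T}w_jC_j(x)\le(1+\varepsilon)\sum_{j=1}^mC_j(x)$. *)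

theory Defs
  imports Complex_Main "HOL-Algebra.Ring" "HOL-Computational_Algebra.Primes"
begin

text \<open>Tuples in F^r are represented as functions nat => 'a whose entries with index < r
  lie in the carrier. A predicate of arity r is a map P from such tuples to bool
  (True = 1, False = 0).\<close>

definition affine_pred :: "('a, 'b) ring_scheme \<Rightarrow> nat \<Rightarrow> ((nat \<Rightarrow> 'a) \<Rightarrow> bool) \<Rightarrow> bool" where
  "affine_pred R r P \<longleftrightarrow>
     (\<exists>a0 \<in> carrier R. \<exists>a. (\<forall>i<r. a i \<in> carrier R) \<and>
        (\<forall>b. (\<forall>i<r. b i \<in> carrier R) \<longrightarrow>
              (\<not> P b \<longleftrightarrow> a0 \<oplus>\<^bsub>R\<^esub> finsum R (\<lambda>i. a i \<otimes>\<^bsub>R\<^esub> b i) {..<r} = \<zero>\<^bsub>R\<^esub>)))"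

definition constr_val :: "('a, 'b) ring_scheme \<Rightarrow> nat \<Rightarrow> ((nat \<Rightarrow> 'a) \<Rightarrow> bool) \<Rightarrow> (nat \<Rightarrow> nat)
    \<Rightarrow> (nat \<Rightarrow> 'a) \<Rightarrow> real" where
  "constr_val R r P idx x = (if P (\<lambda>i. if i < r then x (idx i) else \<zero>\<^bsub>R\<^esub>) then 1 else 0)"

end

theory Submission
  imports Defs
begin

text \<open>
After homogenisation the constraints are linear functionals on \<open>F\<^sub>q\<^sup>k\<^sup>+\<^sup>1\<close>, and the satisfied
constraints of an assignment form the support of a codeword. As in the graph sparsifiers of
Benczur and Karger, every functional \<open>e\<close> gets a strength \<open>\<kappa> e\<close>, read off from the principal
partition of the linear matroid of the functionals, with \<open>\<Sum>e. 1 / \<kappa> e\<close> equal to the rank;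
\<open>e\<close> is kept with probability \<open>p e = min 1 (L / \<kappa> e)\<close>, where \<open>L\<close> is of order \<open>ln (q k) / \<epsilon>\<^sup>2\<close>,
and then gets weight \<open>1 / p e\<close>.

Restrict the code to a superlevel set of \<open>\<kappa>\<close> and give \<open>e\<close> the weight \<open>1 / \<kappa> e\<close>. Then every
subcode of dimension \<open>d\<close> has a support of weight at least \<open>d\<close>, so by Karger's contraction
argument at most \<open>(q (k + 1))\<^sup>\<alpha>\<close> supports have weight at most \<open>\<alpha>\<close>. This balances the Chernoff
bound, and a union bound over all supports and the at most \<open>k + 1\<close> superlevel sets applies. The
original unweighted count is a nonnegative combination of the counts in the superlevel sets.
The probabilistic argument is carried out by the method of conditional expectations.
\<close>

section \<open>Importance sampling\<close>

text \<open>The right side is the expectation of the left when each \<open>e\<close> enters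
  \<open>T\<close> independently with probability \<open>p e\<close>. It is a convex combination of
  its values conditioned on one element being in or out, and the smaller one is followed. The
  coefficients \<open>c\<close> are arbitrary so that they can absorb the factors already
  decided.\<close>

lemma exists_subset_le_expectation:
  fixes c :: "'i \<Rightarrow> real"
  assumes "finite E" and "\<And>e. e \<in> E \<Longrightarrow> 0 \<le> p e \<and> p e \<le> 1"
  shows "\<exists>T\<subseteq>E. (\<Sum>i\<in>I. c i * (\<Prod>e\<in>E. if e \<in> T then g i e else h i e))
           \<le> (\<Sum>i\<in>I. c i * (\<Prod>e\<in>E. p e * g i e + (1 - p e) * h i e))"
  using assms
proof (induction E arbitrary: c rule: finite_induct)
  case empty
  then show ?case by auto
next
  case (insert a E)
  define F where "F c T = (\<Sum>i\<in>I. c i * (\<Prod>e\<in>E. if e \<in> T then g i e else h i e))" for c T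
  define G where "G c = (\<Sum>i\<in>I. c i * (\<Prod>e\<in>E. p e * g i e + (1 - p e) * h i e))" for c
  have IH: "\<exists>T\<subseteq>E. F c T \<le> G c" for c
    unfolding F_def G_def using insert by auto
  have p: "0 \<le> p a" "p a \<le> 1" using insert.prems by auto
  obtain T1 where T1: "T1 \<subseteq> E" "F (\<lambda>i. c i * g i a) T1 \<le> G (\<lambda>i. c i * g i a)" using IH by blast
  obtain T2 where T2: "T2 \<subseteq> E" "F (\<lambda>i. c i * h i a) T2 \<le> G (\<lambda>i. c i * h i a)" using IH by blast
  have in1: "(\<Sum>i\<in>I. c i * (\<Prod>e\<in>insert a E. if e \<in> insert a T1 then g i e else h i e))
      = F (\<lambda>i. c i * g i a) T1"
    unfolding F_def using insert.hyps
    by (intro sum.cong refl) (auto simp: mult.assoc intro!: prod.cong)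
  have in2: "(\<Sum>i\<in>I. c i * (\<Prod>e\<in>insert a E. if e \<in> T2 then g i e else h i e))
      = F (\<lambda>i. c i * h i a) T2"
    unfolding F_def using insert.hyps T2(1)
    by (intro sum.cong refl) (auto simp: mult.assoc intro!: prod.cong)
  have rhs: "(\<Sum>i\<in>I. c i * (\<Prod>e\<in>insert a E. p e * g i e + (1 - p e) * h i e))
      = p a * G (\<lambda>i. c i * g i a) + (1 - p a) * G (\<lambda>i. c i * h i a)"
    unfolding G_def sum_distrib_left sum.distrib[symmetric] using insert.hyps
    by (intro sum.cong refl) (simp add: algebra_simps)
  show ?case
  proof (cases "G (\<lambda>i. c i * g i a) \<le> G (\<lambda>i. c i * h i a)")
    case True
    have "G (\<lambda>i. c i * g i a) \<le> p a * G (\<lambda>i. c i * g i a) + (1 - p a) * G (\<lambda>i. c i * h i a)"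
      using mult_left_mono[OF True, of "1 - p a"] p by (simp add: algebra_simps)
    then show ?thesis using T1 in1 rhs by (intro exI[of _ "insert a T1"]) auto
  next
    case False
    have "G (\<lambda>i. c i * h i a) \<le> p a * G (\<lambda>i. c i * g i a) + (1 - p a) * G (\<lambda>i. c i * h i a)"
      using mult_left_mono[of "G (\<lambda>i. c i * h i a)" "G (\<lambda>i. c i * g i a)" "p a"] False p
      by (simp add: algebra_simps)
    then show ?thesis using T2 in2 rhs by (intro exI[of _ T2]) auto
  qed
qed

section \<open>Chernoff estimates for independent sampling\<close>

lemma exp_le_quadratic:
  fixes y :: real
  assumes "\<bar>y\<bar> \<le> 1"
  shows "exp y \<le> 1 + y + y\<^sup>2"
proof (cases "0 \<le> y")
  case True
  then show ?thesis using exp_bound assms by auto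
next
  case False
  \<comment> \<open>For negative \<open>y\<close> this product exceeds 1, and replacing
    \<open>1 - y\<close> by the larger \<open>exp (- y)\<close> gives the claim.\<close>
  have "(1 + y + y\<^sup>2) * (1 - y) = 1 - y ^ 3"
    by (simp add: algebra_simps power2_eq_square power3_eq_cube)
  moreover have "y ^ 3 < 0" using False by simp
  ultimately have 1: "1 \<le> (1 + y + y\<^sup>2) * (1 - y)" by linarith
  have pos: "0 < 1 + y + y\<^sup>2"
    using False 1 by (smt (verit) mult_nonpos_nonneg)
  have "1 - y \<le> exp (- y)" using exp_ge_add_one_self[of "- y"] by simp
  then have "1 \<le> (1 + y + y\<^sup>2) * exp (- y)"
    using 1 pos by (smt (verit) mult_left_mono)
  then show ?thesis by (simp add: exp_minus field_simps)
qed

text \<open>This is the moment generating function of a centred Bernoulli variable: pull out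
  \<open>exp (- (y * p))\<close> and use \<open>1 + z \<le> exp z\<close>. The factor
  \<open>p\<close> in the exponent lets the bounds for several elements add up to a multiple of
  their total weight.\<close>

lemma bernoulli_mgf_le:
  fixes p y :: real
  assumes p: "0 \<le> p" and y: "\<bar>y\<bar> \<le> 1"
  shows "p * exp (y * (1 - p)) + (1 - p) * exp (- (y * p)) \<le> exp (p * y\<^sup>2)"
proof -
  have "p * exp (y * (1 - p)) + (1 - p) * exp (- (y * p)) = exp (- (y * p)) * (1 + p * (exp y - 1))"
    by (simp add: algebra_simps exp_diff exp_add exp_minus divide_inverse)
  also have "\<dots> \<le> exp (- (y * p)) * exp (p * (exp y - 1))"
    by (intro mult_left_mono exp_ge_add_one_self) auto
  also have "\<dots> = exp (p * (exp y - 1 - y))"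
    by (simp add: exp_add[symmetric] algebra_simps)
  also have "\<dots> \<le> exp (p * y\<^sup>2)"
    using exp_le_quadratic[OF y] p by (simp add: mult_left_mono)
  finally show ?thesis .
qed

text \<open>One potential has a term for the size of \<open>T\<close> and one for each side of each
  deviation. Its expectation is below 1 and its terms are nonnegative, so the set found by
  conditional expectations keeps every single term below 1 and thus avoids all bad events at
  once.\<close>

lemma importance_sampling:
  fixes u :: "'a \<Rightarrow> real" and Y :: "'j \<Rightarrow> 'a set"
  assumes fin: "finite E" "finite J" and u: "\<And>e. e \<in> E \<Longrightarrow> 0 < u e"
    and Y: "\<And>j. j \<in> J \<Longrightarrow> Y j \<subseteq> E"
    and eps: "0 < \<epsilon>" "\<epsilon> \<le> 1" and L: "0 < L" and n: "sum u E \<le> n" "1 \<le> n * L"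
    and small: "(\<Sum>j\<in>J. exp (- (\<epsilon>\<^sup>2 * L / 4 * sum u (Y j)))) \<le> 1 / 4"
  shows "\<exists>T\<subseteq>E. \<exists>w. (\<forall>e\<in>E. 0 \<le> w e) \<and> real (card T) \<le> 4 * n * L \<and>
    (\<forall>j\<in>J. \<bar>\<Sum>e\<in>Y j. u e * (w e * of_bool (e \<in> T) - 1)\<bar> \<le> \<epsilon> * sum u (Y j))"
proof -
  define p where "p e = min 1 (L * u e)" for e
  define w where "w e = 1 / p e" for e
  \<comment> \<open>This \<open>t\<close> minimises \<open>t\<^sup>2 / L - t * \<epsilon>\<close>,
    the exponent per unit of \<open>u\<close>-weight; the minimum is
    \<open>- \<epsilon>\<^sup>2 * L / 4\<close>.\<close>
  define t where "t = \<epsilon> * L / 2"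
  have p: "0 < p e" "p e \<le> 1" if "e \<in> E" for e
    using u[OF that] L by (auto simp: p_def)
  \<comment> \<open>\<open>None\<close> stands for the size of \<open>T\<close>,
    \<open>Some (j, s)\<close> for the deviation on \<open>Y j\<close> with sign \<open>s\<close>.
    The factors \<open>c\<close> are normalised so that a term is below 1 exactly when its bound
    holds strictly.\<close>
  define I where "I = insert None (Some ` (J \<times> {1, -1::real}))"
  define c where "c i = (case i of None \<Rightarrow> exp (- (4 * n * L))
      | Some (j, s) \<Rightarrow> exp (- (t * \<epsilon> * sum u (Y j))))" for i :: "('j \<times> real) option"
  define g where "g i e = (case i of None \<Rightarrow> exp 1
      | Some (j, s) \<Rightarrow> if e \<in> Y j then exp (s * t * (u e * (w e - 1))) else 1)"
    for i :: "('j \<times> real) option" and e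
  define h where "h i e = (case i of None \<Rightarrow> 1
      | Some (j, s) \<Rightarrow> if e \<in> Y j then exp (s * t * (- u e)) else 1)"
    for i :: "('j \<times> real) option" and e
  obtain T where T: "T \<subseteq> E"
    "(\<Sum>i\<in>I. c i * (\<Prod>e\<in>E. if e \<in> T then g i e else h i e))
      \<le> (\<Sum>i\<in>I. c i * (\<Prod>e\<in>E. p e * g i e + (1 - p e) * h i e))"
    using exists_subset_le_expectation[where E = E and p = p and I = I and c = c and g = g and h = h] fin p
    by (auto simp: less_imp_le)
  define V where "V i = c i * (\<Prod>e\<in>E. if e \<in> T then g i e else h i e)" for i
  have finI: "finite I" using fin by (simp add: I_def)
  have None_le: "c None * (\<Prod>e\<in>E. p e * g None e + (1 - p e) * h None e) \<le> 1 / 3"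
  proof -
    have "(\<Prod>e\<in>E. p e * g None e + (1 - p e) * h None e) \<le> (\<Prod>e\<in>E. exp (2 * L * u e))"
    proof (intro prod_mono conjI)
      fix e assume e: "e \<in> E"
      show "0 \<le> p e * g None e + (1 - p e) * h None e"
        using p[OF e] by (simp add: g_def h_def)
      have "p e * g None e + (1 - p e) * h None e = 1 + p e * (exp 1 - 1)"
        by (simp add: g_def h_def algebra_simps)
      also have "\<dots> \<le> 1 + p e * 2"
        using exp_le p[OF e] by (intro add_left_mono mult_left_mono) auto
      also have "\<dots> \<le> exp (p e * 2)" by (rule exp_ge_add_one_self)
      also have "\<dots> \<le> exp (2 * L * u e)" by (simp add: p_def min_def)
      finally show "p e * g None e + (1 - p e) * h None e \<le> exp (2 * L * u e)" .
    qed
    also have "\<dots> = exp (2 * L * sum u E)"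
      using fin by (simp add: exp_sum sum_distrib_left)
    also have "\<dots> \<le> exp (2 * L * n)" using n L by simp
    finally have "c None * (\<Prod>e\<in>E. p e * g None e + (1 - p e) * h None e)
        \<le> exp (- (4 * n * L)) * exp (2 * L * n)"
      by (simp add: c_def)
    also have "\<dots> = exp (- (2 * (n * L)))" by (simp add: exp_add[symmetric] algebra_simps)
    also have "\<dots> \<le> exp (- 2)" using n by simp
    also have "\<dots> \<le> 1 / 3" using exp_ge_add_one_self[of 2] by (simp add: exp_minus field_simps)
    finally show ?thesis .
  qed
  have Some_le: "c (Some (j, s)) * (\<Prod>e\<in>E. p e * g (Some (j, s)) e + (1 - p e) * h (Some (j, s)) e)
      \<le> exp (- (\<epsilon>\<^sup>2 * L / 4 * sum u (Y j)))" if j: "j \<in> J" and s: "s \<in> {1, -1}" for j s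
  proof -
    let ?i = "Some (j, s)"
    have s2: "s * s = 1" "\<bar>s\<bar> = 1" using s by auto
    have factor: "p e * g ?i e + (1 - p e) * h ?i e \<le> exp (\<epsilon>\<^sup>2 * L / 4 * u e)"
      if e: "e \<in> E" "e \<in> Y j" for e
    proof (cases "L * u e < 1")
      case True
      \<comment> \<open>Below saturation a kept element counts \<open>u e / p e = 1 / L\<close>,
        whatever its weight, so the exponent is a centred Bernoulli variable scaled by
        \<open>s * \<epsilon> / 2\<close>.\<close>
      have pe: "p e = L * u e" using True by (simp add: p_def)
      have up: "u e / p e = 1 / L" using pe u[OF e(1)] L by simp
      have y1: "s * t * (u e * (w e - 1)) = s * \<epsilon> / 2 * (1 - p e)"
        using pe u[OF e(1)] L by (simp add: w_def t_def field_simps)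
      have y2: "s * t * u e = s * \<epsilon> / 2 * p e"
        using pe u[OF e(1)] L by (simp add: t_def field_simps)
      have "p e * exp (s * \<epsilon> / 2 * (1 - p e)) + (1 - p e) * exp (- (s * \<epsilon> / 2 * p e))
          \<le> exp (p e * (s * \<epsilon> / 2)\<^sup>2)"
        using p[OF e(1)] eps s2 by (intro bernoulli_mgf_le) (auto simp: abs_mult)
      also have "p e * (s * \<epsilon> / 2)\<^sup>2 = \<epsilon>\<^sup>2 * L / 4 * u e"
        using s by (auto simp: pe power2_eq_square)
      finally show ?thesis using e by (simp add: g_def h_def y1 y2)
    next
      case False
      \<comment> \<open>Such an element is kept with certainty and weight 1, so it causes no
        deviation.\<close>
      then have "p e = 1" by (simp add: p_def)
      then show ?thesis using e u[OF e(1)] L by (simp add: g_def w_def)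
    qed
    have "(\<Prod>e\<in>E. p e * g ?i e + (1 - p e) * h ?i e)
        \<le> (\<Prod>e\<in>E. if e \<in> Y j then exp (\<epsilon>\<^sup>2 * L / 4 * u e) else 1)"
    proof (intro prod_mono conjI)
      fix e assume e: "e \<in> E"
      show "0 \<le> p e * g ?i e + (1 - p e) * h ?i e"
        using p[OF e] by (simp add: g_def h_def)
      show "p e * g ?i e + (1 - p e) * h ?i e \<le> (if e \<in> Y j then exp (\<epsilon>\<^sup>2 * L / 4 * u e) else 1)"
        using factor[OF e] by (simp add: g_def h_def)
    qed
    also have "\<dots> = (\<Prod>e\<in>Y j. exp (\<epsilon>\<^sup>2 * L / 4 * u e))"
      using fin Y[OF j] by (simp add: prod.inter_restrict[symmetric] Int_absorb1)
    also have "\<dots> = exp (\<epsilon>\<^sup>2 * L / 4 * sum u (Y j))"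
      using fin Y[OF j] by (simp add: exp_sum sum_distrib_left finite_subset)
    finally have "c ?i * (\<Prod>e\<in>E. p e * g ?i e + (1 - p e) * h ?i e)
        \<le> exp (- (t * \<epsilon> * sum u (Y j))) * exp (\<epsilon>\<^sup>2 * L / 4 * sum u (Y j))"
      by (simp add: c_def)
    also have "\<dots> = exp (- (\<epsilon>\<^sup>2 * L / 4 * sum u (Y j)))"
      by (simp add: exp_add[symmetric] t_def power2_eq_square)
    finally show ?thesis .
  qed
  have "(\<Sum>i\<in>I. V i) \<le> 1 / 3 + (\<Sum>(j, s)\<in>J \<times> {1, -1::real}. exp (- (\<epsilon>\<^sup>2 * L / 4 * sum u (Y j))))"
  proof -
    have "(\<Sum>i\<in>I. V i) \<le> (\<Sum>i\<in>I. c i * (\<Prod>e\<in>E. p e * g i e + (1 - p e) * h i e))"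
      using T by (simp add: V_def)
    also have "\<dots> = c None * (\<Prod>e\<in>E. p e * g None e + (1 - p e) * h None e)
        + (\<Sum>i\<in>J \<times> {1, -1::real}. c (Some i) * (\<Prod>e\<in>E. p e * g (Some i) e + (1 - p e) * h (Some i) e))"
      unfolding I_def using fin by (subst sum.insert) (auto simp: sum.reindex)
    also have "\<dots> \<le> 1 / 3 + (\<Sum>(j, s)\<in>J \<times> {1, -1::real}. exp (- (\<epsilon>\<^sup>2 * L / 4 * sum u (Y j))))"
      using None_le Some_le by (intro add_mono sum_mono) (auto simp: case_prod_beta)
    finally show ?thesis .
  qed
  also have "(\<Sum>(j, s)\<in>J \<times> {1, -1::real}. exp (- (\<epsilon>\<^sup>2 * L / 4 * sum u (Y j))))
      = 2 * (\<Sum>j\<in>J. exp (- (\<epsilon>\<^sup>2 * L / 4 * sum u (Y j))))"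
    by (simp add: sum.cartesian_product[symmetric] sum_distrib_left)
  \<comment> \<open>The budget is 1/3 for the size and 1/4 for each of the two signs.\<close>
  finally have "(\<Sum>i\<in>I. V i) < 1" using small by linarith
  moreover have "V i \<ge> 0" for i
    unfolding V_def by (intro mult_nonneg_nonneg prod_nonneg) (auto simp: c_def g_def h_def split: option.splits)
  ultimately have V1: "V i < 1" if "i \<in> I" for i
    using member_le_sum[of i I V] finI that by force
  have "V None = exp (real (card T) - 4 * n * L)"
  proof -
    have "(\<Prod>e\<in>E. if e \<in> T then g None e else h None e) = (\<Prod>e\<in>E. if e \<in> T then exp 1 else 1)"
      by (intro prod.cong) (auto simp: g_def h_def)
    also have "\<dots> = (\<Prod>e\<in>T. exp 1)"
      using fin T(1) by (simp add: prod.inter_restrict[symmetric] Int_absorb1)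
    also have "\<dots> = exp (real (card T))" by (simp add: exp_of_nat_mult[symmetric])
    finally show ?thesis by (simp add: V_def c_def exp_add[symmetric])
  qed
  then have card: "real (card T) \<le> 4 * n * L" using V1[of None] by (simp add: I_def)
  have dev: "s * (\<Sum>e\<in>Y j. u e * (w e * of_bool (e \<in> T) - 1)) \<le> \<epsilon> * sum u (Y j)"
    if j: "j \<in> J" and s: "s \<in> {1, -1}" for j s
  proof -
    let ?i = "Some (j, s)"
    have "(\<Prod>e\<in>E. if e \<in> T then g ?i e else h ?i e)
        = (\<Prod>e\<in>E. if e \<in> Y j then exp (s * t * (u e * (w e * of_bool (e \<in> T) - 1))) else 1)"
      by (intro prod.cong) (auto simp: g_def h_def)
    also have "\<dots> = (\<Prod>e\<in>Y j. exp (s * t * (u e * (w e * of_bool (e \<in> T) - 1))))"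
      using fin Y[OF j] by (simp add: prod.inter_restrict[symmetric] Int_absorb1)
    also have "\<dots> = exp (s * t * (\<Sum>e\<in>Y j. u e * (w e * of_bool (e \<in> T) - 1)))"
      using fin Y[OF j] by (simp add: exp_sum sum_distrib_left finite_subset)
    finally have "V ?i = exp (t * (s * (\<Sum>e\<in>Y j. u e * (w e * of_bool (e \<in> T) - 1)) - \<epsilon> * sum u (Y j)))"
      by (simp add: V_def c_def exp_add[symmetric] algebra_simps)
    moreover have "V ?i < 1" using j s by (intro V1) (auto simp: I_def)
    ultimately have "t * (s * (\<Sum>e\<in>Y j. u e * (w e * of_bool (e \<in> T) - 1)) - \<epsilon> * sum u (Y j)) < 0"
      by simp
    then show ?thesis using eps L by (simp add: t_def mult_less_0_iff)
  qed
  have "\<bar>\<Sum>e\<in>Y j. u e * (w e * of_bool (e \<in> T) - 1)\<bar> \<le> \<epsilon> * sum u (Y j)" if "j \<in> J" for j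
    using dev[OF that, of 1] dev[OF that, of "-1"] by auto
  moreover have "\<forall>e\<in>E. 0 \<le> w e" using p by (simp add: w_def less_imp_le)
  ultimately show ?thesis using T(1) card by blast
qed

text \<open>Abel summation over the superlevel sets of \<open>\<kappa>\<close>.\<close>
lemma sum_mult_nonneg_if_superlevel_sums_nonneg:
  fixes \<kappa> h :: "'a \<Rightarrow> real"
  assumes "finite Y" and "\<And>e. e \<in> Y \<Longrightarrow> 0 \<le> \<kappa> e"
    and "\<And>\<theta>. \<theta> \<in> \<kappa> ` Y \<Longrightarrow> 0 \<le> sum h {e \<in> Y. \<theta> \<le> \<kappa> e}"
  shows "0 \<le> (\<Sum>e\<in>Y. \<kappa> e * h e)"
  using assms
proof (induction Y arbitrary: \<kappa> rule: finite_psubset_induct)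
  case (psubset Y)
  show ?case
  proof (cases "Y = {}")
    case False
    define \<theta> where "\<theta> = Min (\<kappa> ` Y)"
    have \<theta>: "\<theta> \<in> \<kappa> ` Y" "\<And>e. e \<in> Y \<Longrightarrow> \<theta> \<le> \<kappa> e"
      using psubset.hyps False by (auto simp: \<theta>_def)
    define Y' where "Y' = {e \<in> Y. \<theta> < \<kappa> e}"
    have sub: "Y' \<subset> Y" using \<theta>(1) by (auto simp: Y'_def)
    have Y: "{e \<in> Y. \<theta> \<le> \<kappa> e} = Y" using \<theta>(2) by auto
    \<comment> \<open>Lowering all levels by the minimum makes the elements at the minimum drop out
      and leaves the other superlevel sets unchanged. The part removed is \<open>\<theta>\<close>
      times the sum over \<open>Y\<close>, which is itself a superlevel sum.\<close>
    have "0 \<le> (\<Sum>e\<in>Y'. (\<kappa> e - \<theta>) * h e)"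
    proof (rule psubset.IH[OF sub])
      fix \<eta> assume "\<eta> \<in> (\<lambda>e. \<kappa> e - \<theta>) ` Y'"
      then obtain a where a: "a \<in> Y" "\<theta> < \<kappa> a" "\<eta> = \<kappa> a - \<theta>" by (auto simp: Y'_def)
      then have "{e \<in> Y'. \<eta> \<le> \<kappa> e - \<theta>} = {e \<in> Y. \<kappa> a \<le> \<kappa> e}" by (auto simp: Y'_def)
      then show "0 \<le> sum h {e \<in> Y'. \<eta> \<le> \<kappa> e - \<theta>}" using psubset.prems(2)[of "\<kappa> a"] a by auto
    qed (auto simp: Y'_def)
    also have "\<dots> = (\<Sum>e\<in>Y. (\<kappa> e - \<theta>) * h e)"
      using psubset.hyps sub \<theta>(2) by (intro sum.mono_neutral_left) (force simp: Y'_def)+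
    finally have "0 \<le> (\<Sum>e\<in>Y. (\<kappa> e - \<theta>) * h e)" .
    moreover have "0 \<le> \<theta> * sum h Y"
      using psubset.prems \<theta>(1) Y by (metis imageE mult_nonneg_nonneg)
    moreover have "(\<Sum>e\<in>Y. \<kappa> e * h e) = (\<Sum>e\<in>Y. (\<kappa> e - \<theta>) * h e) + \<theta> * sum h Y"
      by (simp add: sum_distrib_left sum.distrib[symmetric] algebra_simps)
    ultimately show ?thesis by linarith
  qed simp
qed

section \<open>Strength and contraction in the matroid of a code\<close>

text \<open>\<open>Supp\<close> is the set of supports of the words of a linear code over the field with \<open>q\<close>
  elements, and \<open>r S\<close> is the codimension of the subcode vanishing on \<open>S\<close>. The condition in
  \<open>r_insert\<close> says that coordinate \<open>e\<close> is identically zero on that subcode.\<close>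
locale support_matroid =
  fixes E :: "'a set" and Supp :: "'a set set" and r :: "'a set \<Rightarrow> nat" and q :: nat
  assumes finite_E: "finite E" and Union_Supp: "\<Union>Supp = E" and q_pos: "1 \<le> q"
    and r_empty: "r {} = 0"
    and r_insert: "\<lbrakk>S \<subseteq> E; e \<in> E\<rbrakk> \<Longrightarrow>
      r (insert e S) = (if \<forall>Y\<in>Supp. Y \<inter> S = {} \<longrightarrow> e \<notin> Y then r S else Suc (r S))"
    and card_restrict: "\<lbrakk>S \<subseteq> W; W \<subseteq> E\<rbrakk> \<Longrightarrow>
      card ((\<lambda>Y. Y \<inter> W) ` {Y \<in> Supp. Y \<inter> S = {}}) \<le> q ^ (r W - r S)"
begin

section \<open>Monotonicity and submodularity of the rank\<close>

lemma finite_Supp: "finite Supp"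
  using finite_E Union_Supp by (metis finite_UnionD)

lemma finite_subset_E: "W \<subseteq> E \<Longrightarrow> finite W"
  using finite_E finite_subset by blast

text \<open>A coordinate that is zero on the subcode vanishing on \<open>A\<close> is also zero on
  the smaller subcode vanishing on \<open>B\<close>. Hence each element of \<open>D\<close> raises
  the rank over \<open>B\<close> at most as much as over \<open>A\<close>.\<close>

lemma r_Un_diminishing:
  assumes "A \<subseteq> B" "B \<subseteq> E" "D \<subseteq> E"
  shows "r (B \<union> D) + r A \<le> r (A \<union> D) + r B \<and> r A \<le> r (A \<union> D)"
  using finite_subset_E[OF assms(3)] assms(3)
proof (induction D rule: finite_induct)
  case (insert e D)
  have sub: "A \<union> D \<subseteq> E" "B \<union> D \<subseteq> E" "e \<in> E" using insert.prems assms by auto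
  define zero where "zero S \<longleftrightarrow> (\<forall>Y\<in>Supp. Y \<inter> S = {} \<longrightarrow> e \<notin> Y)" for S
  have "zero (A \<union> D) \<Longrightarrow> zero (B \<union> D)" using assms(1) unfolding zero_def by blast
  moreover have "r (A \<union> insert e D) = (if zero (A \<union> D) then r (A \<union> D) else Suc (r (A \<union> D)))"
    "r (B \<union> insert e D) = (if zero (B \<union> D) then r (B \<union> D) else Suc (r (B \<union> D)))"
    using sub unfolding Un_insert_right zero_def by (intro r_insert; simp)+
  moreover have "r (B \<union> D) + r A \<le> r (A \<union> D) + r B \<and> r A \<le> r (A \<union> D)"
    using insert by simp
  ultimately show ?case by (simp split: if_splits)
qed simp

lemma r_mono: "\<lbrakk>A \<subseteq> B; B \<subseteq> E\<rbrakk> \<Longrightarrow> r A \<le> r B"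
  using r_Un_diminishing[of A A B] by (auto simp: Un_absorb1)

lemma r_submodular: "\<lbrakk>A \<subseteq> E; B \<subseteq> E\<rbrakk> \<Longrightarrow> r (A \<union> B) + r (A \<inter> B) \<le> r A + r B"
  using r_Un_diminishing[of "A \<inter> B" A B] by (auto simp: Un_absorb1)

lemma r_singleton: "e \<in> E \<Longrightarrow> r {e} = 1"
  using r_insert[of "{}" e] Union_Supp r_empty by auto

lemma r_pos: "\<lbrakk>W \<subseteq> E; W \<noteq> {}\<rbrakk> \<Longrightarrow> 0 < r W"
  using r_mono[of "{e}" W for e] r_singleton by fastforce

text \<open>\<open>\<kappa>\<close> is the strength: peel off the sparsest quotient \<open>W / F\<close>, give its elements the
  strength \<open>|W - F| / (r W - r F)\<close>, and recurse into \<open>F\<close>. The third conjunct keeps the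
  strengths found in \<open>F\<close> at least that large.\<close>
lemma exists_strength:
  assumes "W \<subseteq> E"
  shows "\<exists>\<kappa>::'a \<Rightarrow> real. (\<forall>e\<in>W. 0 < \<kappa> e) \<and> (\<Sum>e\<in>W. 1 / \<kappa> e) = r W \<and> card (\<kappa> ` W) \<le> r W \<and>
    (\<forall>l::real. (\<forall>S\<subseteq>W. l * (real (r W) - r S) \<le> card (W - S)) \<longrightarrow> (\<forall>e\<in>W. l \<le> \<kappa> e)) \<and>
    (\<forall>\<theta>. \<forall>S\<subseteq>{e \<in> W. \<theta> \<le> \<kappa> e}.
       real (r {e \<in> W. \<theta> \<le> \<kappa> e}) - r S \<le> (\<Sum>e\<in>{e \<in> W. \<theta> \<le> \<kappa> e} - S. 1 / \<kappa> e))"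
  using finite_subset_E[OF assms] assms
proof (induction W rule: finite_psubset_induct)
  case (psubset W)
  show ?case
  proof (cases "W = {}")
    case True
    then show ?thesis by (intro exI[of _ "\<lambda>_. 1"]) (auto simp: r_empty)
  next
    case False
    \<comment> \<open>Only sets of smaller rank compete, so that the denominator of
      \<open>dens\<close> is positive; the empty set is one of them.\<close>
    define C where "C = {S. S \<subseteq> W \<and> r S < r W}"
    define dens where "dens S = real (card (W - S)) / (real (r W) - r S)" for S
    have "finite C" using psubset.hyps by (simp add: C_def)
    moreover have "{} \<in> C" using r_pos[OF psubset.prems False] r_empty by (simp add: C_def)
    ultimately obtain F where F: "F \<in> C" "\<And>S. S \<in> C \<Longrightarrow> dens F \<le> dens S"
      using ex_is_arg_min_if_finite[of C dens] unfolding is_arg_min_linorder by blast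
    define l where "l = dens F"
    have FW: "F \<subset> W" "r F < r W" using F by (auto simp: C_def)
    have FE: "F \<subseteq> E" using FW psubset.prems by auto
    have finW: "finite W" by (rule psubset.hyps)
    have finF: "finite F" using FW finW finite_subset by blast
    have l_pos: "0 < l"
      using FW finW unfolding l_def dens_def by (auto simp: card_gt_0_iff finite_subset intro!: divide_pos_pos)
    have l_eq: "real (card (W - F)) = l * (real (r W) - r F)" using FW by (simp add: l_def dens_def)
    have l_le: "l * (real (r W) - r S) \<le> card (W - S)" if "S \<subseteq> W" for S
    proof (cases "S \<in> C")
      case True
      then show ?thesis using F(2)[OF True] unfolding l_def dens_def[of S] 
        by (simp add: C_def field_simps)
    next
      case False
      then have "l * (real (r W) - r S) \<le> 0"
        using that l_pos by (intro mult_nonneg_nonpos) (auto simp: C_def)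
      then show ?thesis by (rule order_trans) simp
    qed
    obtain \<kappa>' :: "'a \<Rightarrow> real" where "\<forall>e\<in>F. 0 < \<kappa>' e" and k2: "(\<Sum>e\<in>F. 1 / \<kappa>' e) = r F"
      and k3: "card (\<kappa>' ` F) \<le> r F"
      and k4: "\<forall>l::real. (\<forall>S\<subseteq>F. l * (real (r F) - r S) \<le> card (F - S)) \<longrightarrow> (\<forall>e\<in>F. l \<le> \<kappa>' e)"
      and k5: "\<forall>\<theta>. \<forall>S\<subseteq>{e \<in> F. \<theta> \<le> \<kappa>' e}.
       real (r {e \<in> F. \<theta> \<le> \<kappa>' e}) - r S \<le> (\<Sum>e\<in>{e \<in> F. \<theta> \<le> \<kappa>' e} - S. 1 / \<kappa>' e)"
      using psubset.IH[OF FW(1) FE] by (elim exE conjE) (rule that)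
    have card_split: "real (card (W - S)) = card (W - F) + card (F - S)" if "S \<subseteq> F" for S
    proof -
      have "W - S = (W - F) \<union> (F - S)" using that FW by auto
      then have "card (W - S) = card (W - F) + card (F - S)"
        using finW finF by (simp add: card_Un_disjoint disjoint_iff)
      then show ?thesis by simp
    qed
    \<comment> \<open>\<open>F\<close> attains the density \<open>l\<close>, so subtracting
      \<open>l_eq\<close> from the inequality for a subset \<open>S\<close> of \<open>F\<close>
      leaves the premise of \<open>k4\<close>.\<close>
    have lF: "l \<le> \<kappa>' e" if "e \<in> F" for e
    proof (rule k4[rule_format])
      show "e \<in> F" by (rule that)
      fix S assume S: "S \<subseteq> F"
      have "l * (real (r W) - r S) \<le> card (W - S)" using S FW by (intro l_le) auto
      then show "l * (real (r F) - r S) \<le> card (F - S)"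
        using card_split[OF S] l_eq by (simp add: algebra_simps)
    qed
    define \<kappa> where "\<kappa> e = (if e \<in> F then \<kappa>' e else l)" for e
    have \<kappa>F: "e \<in> F \<Longrightarrow> \<kappa> e = \<kappa>' e" and \<kappa>nF: "e \<notin> F \<Longrightarrow> \<kappa> e = l" for e by (auto simp: \<kappa>_def)
    have l_min: "l \<le> \<kappa> e" for e using lF by (auto simp: \<kappa>_def)
    have sumF: "(\<Sum>e\<in>A. 1 / \<kappa> e) = (\<Sum>e\<in>A. 1 / \<kappa>' e)" if "A \<subseteq> F" for A
      using that by (intro sum.cong) (auto simp: \<kappa>_def)
    have sumnF: "(\<Sum>e\<in>A. 1 / \<kappa> e) = card A / l" if "A \<subseteq> W - F" for A
    proof -
      have "(\<Sum>e\<in>A. 1 / \<kappa> e) = (\<Sum>e\<in>A. 1 / l)" using that by (intro sum.cong) (auto simp: \<kappa>_def)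
      then show ?thesis by simp
    qed
    have "(\<Sum>e\<in>W. 1 / \<kappa> e) = (\<Sum>e\<in>W - F. 1 / \<kappa> e) + (\<Sum>e\<in>F. 1 / \<kappa> e)"
      using FW finW by (intro sum.subset_diff) auto
    also have "\<dots> = r W"
      using sumF[OF order_refl] sumnF[OF order_refl] k2 l_eq l_pos by simp
    finally have c2: "(\<Sum>e\<in>W. 1 / \<kappa> e) = r W" .
    \<comment> \<open>Each peeling adds at most one value and lowers the rank by at least
      one.\<close>
    have "\<kappa> ` W \<subseteq> insert l (\<kappa>' ` F)" by (auto simp: \<kappa>_def)
    then have "card (\<kappa> ` W) \<le> card (insert l (\<kappa>' ` F))" using finF by (intro card_mono) auto
    also have "\<dots> \<le> Suc (card (\<kappa>' ` F))" using finF by (simp add: card_insert_if)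
    also have "\<dots> \<le> r W" using k3 FW by simp
    finally have c3: "card (\<kappa> ` W) \<le> r W" .
    have c4: "l' \<le> \<kappa> e" if l': "\<forall>S\<subseteq>W. l' * (real (r W) - r S) \<le> card (W - S)" for l' e
    proof -
      have "l' * (real (r W) - r F) \<le> l * (real (r W) - r F)" using l' FW l_eq by auto
      then have "l' \<le> l" using FW by simp
      then show ?thesis using l_min[of e] by linarith
    qed
    have c5: "real (r {e \<in> W. \<theta> \<le> \<kappa> e}) - r S \<le> (\<Sum>e\<in>{e \<in> W. \<theta> \<le> \<kappa> e} - S. 1 / \<kappa> e)"
      if S: "S \<subseteq> {e \<in> W. \<theta> \<le> \<kappa> e}" for \<theta> S
    proof (cases "\<theta> \<le> l")
      case True
      then have W: "{e \<in> W. \<theta> \<le> \<kappa> e} = W" by (auto intro: order_trans[OF _ l_min])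
      then have SW: "S \<subseteq> W" using S by simp
      \<comment> \<open>The quotient by \<open>S\<close> is split along \<open>F\<close>: minimality
        of \<open>l\<close> bounds the part \<open>W - (F \<union> S)\<close>, the induction
        hypothesis bounds \<open>F - S\<close>, and submodularity joins the two ranks.\<close>
      have "l * (real (r W) - r (F \<union> S)) \<le> card (W - (F \<union> S))" using SW FW by (intro l_le) auto
      then have 1: "real (r W) - r (F \<union> S) \<le> card (W - (F \<union> S)) / l"
        using l_pos by (simp add: field_simps)
      have F': "{e \<in> F. l \<le> \<kappa>' e} = F" using lF by auto
      have 2: "real (r F) - r (F \<inter> S) \<le> (\<Sum>e\<in>F - S. 1 / \<kappa>' e)"
        using k5[rule_format, of "F \<inter> S" l] F' by (simp add: Diff_Int)
      have 3: "r (F \<union> S) + r (F \<inter> S) \<le> r F + r S"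
        using FE SW psubset.prems by (intro r_submodular) auto
      have "(\<Sum>e\<in>W - S. 1 / \<kappa> e) = (\<Sum>e\<in>(W - S) - (F - S). 1 / \<kappa> e) + (\<Sum>e\<in>F - S. 1 / \<kappa> e)"
        using FW finW by (intro sum.subset_diff) auto
      also have "(W - S) - (F - S) = W - (F \<union> S)" by auto
      finally have "(\<Sum>e\<in>W - S. 1 / \<kappa> e) = card (W - (F \<union> S)) / l + (\<Sum>e\<in>F - S. 1 / \<kappa>' e)"
        using sumF[of "F - S"] sumnF[of "W - (F \<union> S)"] by auto
      then show ?thesis unfolding W using 1 2 3 by linarith
    next
      case False
      then have W: "{e \<in> W. \<theta> \<le> \<kappa> e} = {e \<in> F. \<theta> \<le> \<kappa>' e}"
        using FW by (auto simp: \<kappa>_def split: if_splits)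
      have "{e \<in> F. \<theta> \<le> \<kappa>' e} - S \<subseteq> F" by auto
      then show ?thesis using k5[rule_format, of S \<theta>] S sumF unfolding W by auto
    qed
    have c1: "\<forall>e\<in>W. 0 < \<kappa> e" using l_min l_pos by (auto intro: less_le_trans)
    show ?thesis using c1 c2 c3 c4 c5 by (intro exI[of _ \<kappa>] conjI allI impI ballI) simp_all
  qed
qed

text \<open>Karger's contraction argument: adding to \<open>S\<close> an element drawn with probability
  proportional to \<open>u\<close> keeps a word of weight at most \<open>\<alpha>\<close> alive with probability at least
  \<open>1 - \<alpha> / (r W - r S)\<close>.\<close>
lemma card_light_supports_le:
  fixes u :: "'a \<Rightarrow> real"
  assumes W: "W \<subseteq> E" and u: "\<And>e. e \<in> W \<Longrightarrow> 0 \<le> u e"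
    and strong: "\<And>S. S \<subseteq> W \<Longrightarrow> real (r W) - r S \<le> sum u (W - S)"
    and "S \<subseteq> W"
  shows "card {Z \<in> (\<lambda>Y. Y \<inter> W) ` {Y \<in> Supp. Y \<inter> S = {}}. sum u Z \<le> real \<alpha>}
    \<le> q ^ \<alpha> * (max (r W - r S) \<alpha> choose \<alpha>)"
  using \<open>S \<subseteq> W\<close>
proof (induction "card (W - S)" arbitrary: S rule: less_induct)
  case less
  define D where "D S = {Z \<in> (\<lambda>Y. Y \<inter> W) ` {Y \<in> Supp. Y \<inter> S = {}}. sum u Z \<le> real \<alpha>}" for S
  have finW: "finite W" by (rule finite_subset_E[OF W])
  have finD: "finite (D S)" for S using finite_Supp by (simp add: D_def)
  have smaller: "card (W - insert e S) < card (W - S)" "insert e S \<subseteq> W" if "e \<in> W - S" for e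
  proof -
    show "card (W - insert e S) < card (W - S)" using that finW by (intro psubset_card_mono) auto
    show "insert e S \<subseteq> W" using that less.prems by auto
  qed
  have SE: "S \<subseteq> E" using less.prems W by auto
  have IH: "card (D (insert e S)) \<le> q ^ \<alpha> * (max (r W - r (insert e S)) \<alpha> choose \<alpha>)" if "e \<in> W - S" for e
    unfolding D_def using less.hyps[OF smaller[OF that]] .
  consider (closure) e where "e \<in> W - S" "r (insert e S) = r S"
    | (light) "r W - r S \<le> \<alpha>"
    | (avg) "\<And>e. e \<in> W - S \<Longrightarrow> r (insert e S) = Suc (r S)" "\<alpha> < r W - r S"
  proof (cases "\<exists>e\<in>W - S. r (insert e S) = r S")
    case False
    then have "r (insert e S) = Suc (r S)" if "e \<in> W - S" for e
      using r_insert[OF SE, of e] that W by (metis DiffD1 subsetD)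
    then show ?thesis using light avg by (meson linorder_not_le)
  qed (use closure in blast)
  then have "card (D S) \<le> q ^ \<alpha> * (max (r W - r S) \<alpha> choose \<alpha>)"
  proof cases
    case closure
    then have "e \<in> E" using W by auto
    from r_insert[OF SE this] closure have "\<forall>Y\<in>Supp. Y \<inter> S = {} \<longrightarrow> e \<notin> Y" by (auto split: if_splits)
    then have "{Y \<in> Supp. Y \<inter> S = {}} = {Y \<in> Supp. Y \<inter> insert e S = {}}" by auto
    then have "D S = D (insert e S)" by (simp add: D_def)
    then show ?thesis using IH[OF closure(1)] closure(2) by simp
  next
    case light
    have "card (D S) \<le> card ((\<lambda>Y. Y \<inter> W) ` {Y \<in> Supp. Y \<inter> S = {}})"
      using finite_Supp unfolding D_def by (intro card_mono) auto
    also have "\<dots> \<le> q ^ (r W - r S)" using card_restrict less.prems W by auto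
    also have "\<dots> \<le> q ^ \<alpha>" using light q_pos by (intro power_increasing) auto
    finally show ?thesis using light by (simp add: max_def)
  next
    case avg
    define d where "d = r W - r S"
    define B where "B = q ^ \<alpha> * ((d - 1) choose \<alpha>)"
    define U where "U = sum u (W - S)"
    have dU: "real d \<le> U"
      using strong[OF less.prems] r_mono[OF less.prems W] by (simp add: d_def U_def)
    have ad: "\<alpha> < d" using avg by (simp add: d_def)
    have Dins: "D (insert e S) = {Z \<in> D S. e \<notin> Z}" if "e \<in> W - S" for e
      using that by (auto simp: D_def)
    have cB: "card {Z \<in> D S. e \<notin> Z} \<le> B" if e: "e \<in> W - S" for e
    proof -
      have "max (r W - r (insert e S)) \<alpha> = d - 1" using avg(1)[OF e] ad by (simp add: d_def)
      then show ?thesis using IH[OF e] Dins[OF e] by (simp add: B_def)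
    qed
    \<comment> \<open>Double counting of words and elements outside their supports: a word of weight
      at most \<open>\<alpha>\<close> misses weight at least \<open>U - \<alpha>\<close>, and each
      \<open>e\<close> is missed by at most \<open>B\<close> words.\<close>
    have "(U - \<alpha>) * card (D S) = (\<Sum>Z\<in>D S. U - \<alpha>)" by simp
    also have "\<dots> \<le> (\<Sum>Z\<in>D S. \<Sum>e\<in>W - S. if e \<notin> Z then u e else 0)"
    proof (rule sum_mono)
      fix Z assume Z: "Z \<in> D S"
      then have ZW: "Z \<subseteq> W - S" "sum u Z \<le> \<alpha>" by (auto simp: D_def)
      have "(\<Sum>e\<in>W - S. if e \<notin> Z then u e else 0) = sum u ((W - S) - Z)"
        using finW by (simp add: sum.inter_filter[symmetric] set_diff_eq)
      also have "\<dots> = U - sum u Z" using ZW finW unfolding U_def by (subst sum_diff) auto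
      finally show "U - \<alpha> \<le> (\<Sum>e\<in>W - S. if e \<notin> Z then u e else 0)" using ZW by simp
    qed
    also have "\<dots> = (\<Sum>e\<in>W - S. \<Sum>Z\<in>D S. if e \<notin> Z then u e else 0)" by (rule sum.swap)
    also have "\<dots> = (\<Sum>e\<in>W - S. u e * card {Z \<in> D S. e \<notin> Z})"
      using finD by (simp add: sum.inter_filter[symmetric] mult.commute)
    also have "\<dots> \<le> (\<Sum>e\<in>W - S. u e * B)"
      using cB u by (intro sum_mono mult_left_mono) auto
    also have "\<dots> = U * B" by (simp add: U_def sum_distrib_right)
    finally have le: "(U - \<alpha>) * card (D S) \<le> U * B" .
    have "(real d - \<alpha>) * U \<le> d * (U - \<alpha>)"
      using mult_left_mono[OF dU, of "real \<alpha>"] by (simp add: algebra_simps)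
    then have "(real d - \<alpha>) * U * card (D S) \<le> d * (U - \<alpha>) * card (D S)"
      by (rule mult_right_mono) simp
    also have "\<dots> \<le> d * (U * B)" using mult_left_mono[OF le, of "real d"] by (simp add: mult.assoc)
    finally have "U * ((real d - \<alpha>) * card (D S)) \<le> U * (d * B)" by (simp add: mult_ac)
    then have "(real d - \<alpha>) * card (D S) \<le> d * B" using dU ad by (simp add: mult_le_cancel_left)
    \<comment> \<open>The absorption identity \<open>d * ((d - 1) choose \<alpha>) = (d - \<alpha>)
      * (d choose \<alpha>)\<close> makes the binomial bound reproduce itself under the survival
      factor \<open>(d - \<alpha>) / d\<close>.\<close>
    also have "real (d * B) = real (q ^ \<alpha> * ((d - \<alpha>) * (d choose \<alpha>)))"
      unfolding B_def binomial_absorb_comp by (simp only: mult.left_commute)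
    also have "\<dots> = (real d - \<alpha>) * (q ^ \<alpha> * (d choose \<alpha>))" using ad by (simp add: of_nat_diff)
    finally have "real (card (D S)) \<le> real (q ^ \<alpha> * (d choose \<alpha>))" using ad by simp
    then have "card (D S) \<le> q ^ \<alpha> * (d choose \<alpha>)" by linarith
    then show ?thesis using ad by (simp add: d_def[symmetric] max_def)
  qed
  then show ?case by (simp add: D_def)
qed

end

section \<open>Union bound over supports and superlevel sets\<close>

lemma sum_powers_le_double:
  fixes x :: real
  assumes "finite J" "0 \<notin> J" and x: "0 \<le> x" "x \<le> 1 / 2"
  shows "(\<Sum>j\<in>J. x ^ j) \<le> 2 * x"
proof -
  have part: "(\<Sum>j\<in>{1..m}. x ^ j) \<le> 2 * x - 2 * x * (1 / 2) ^ m" for m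
  proof (induction m)
    case (Suc m)
    have "x * x ^ m \<le> x * (1 / 2) ^ m" using x by (intro mult_left_mono power_mono) auto
    with Suc show ?case by (simp add: algebra_simps)
  qed simp
  have "J \<subseteq> {1..Max J}" using assms by (auto simp: Suc_le_eq) (metis neq0_conv)
  then have "(\<Sum>j\<in>J. x ^ j) \<le> (\<Sum>j\<in>{1..Max J}. x ^ j)" using x by (intro sum_mono2) auto
  also have "\<dots> \<le> 2 * x" using part[of "Max J"] x by (smt (verit) mult_nonneg_nonneg zero_le_power)
  finally show ?thesis .
qed

context support_matroid
begin

text \<open>The word with support \<open>Y\<close> vanishes on \<open>W - Y\<close> but not on all
  of \<open>W\<close>, so \<open>W - Y\<close> has smaller rank than \<open>W\<close>;
  \<open>strong\<close> turns this rank gap into weight.\<close>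

lemma weight_ge_1:
  fixes u :: "'a \<Rightarrow> real"
  assumes W: "W \<subseteq> E" and strong: "\<And>S. S \<subseteq> W \<Longrightarrow> real (r W) - r S \<le> sum u (W - S)"
    and Y: "Y \<in> Supp" "Y \<inter> W \<noteq> {}"
  shows "1 \<le> sum u (Y \<inter> W)"
proof -
  obtain e where e: "e \<in> Y" "e \<in> W" using Y by auto
  have sub: "W - Y \<subseteq> E" "e \<in> E" using W e by auto
  have "Y \<inter> (W - Y) = {}" by auto
  then have "r (insert e (W - Y)) = Suc (r (W - Y))" using r_insert[OF sub] e(1) Y(1) by auto
  moreover have "r (insert e (W - Y)) \<le> r W" using e W by (intro r_mono) auto
  ultimately have "r (W - Y) < r W" by simp
  moreover have "W - (W - Y) = Y \<inter> W" by auto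
  ultimately show ?thesis using strong[of "W - Y"] by auto
qed

text \<open>Traces are grouped by the integer part \<open>j\<close> of their weight. The contraction
  bound on the size of a group is beaten by the decay of the exponential, leaving a geometric
  series. The spare factor \<open>1 / n\<close> pays for the later sum over thresholds.\<close>

lemma sum_exp_weight_le:
  fixes u :: "'a \<Rightarrow> real" and n :: nat
  assumes W: "W \<subseteq> E" and u: "\<And>e. e \<in> W \<Longrightarrow> 0 \<le> u e"
    and strong: "\<And>S. S \<subseteq> W \<Longrightarrow> real (r W) - r S \<le> sum u (W - S)"
    and n: "r W \<le> n" "1 \<le> n"
  shows "(\<Sum>Z\<in>(\<lambda>Y. Y \<inter> W) ` Supp - {{}}. exp (- (ln (8 * real q ^ 2 * real n ^ 3) * sum u Z)))
    \<le> 1 / (4 * real n)"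
proof -
  define A where "A = (\<lambda>Y. Y \<inter> W) ` Supp - {{}}"
  define M where "M = 8 * real q ^ 2 * real n ^ 3"
  define fl where "fl Z = nat \<lfloor>sum u Z\<rfloor>" for Z
  have finA: "finite A" using finite_Supp by (simp add: A_def)
  have qn: "1 \<le> real q" "1 \<le> real n" using q_pos n by auto
  then have qn1: "1 \<le> real q * real n" by (metis mult_mono mult_1 zero_le_one order_trans)
  have M: "0 < M" "1 \<le> M"
  proof -
    have "1 \<le> real q ^ 2" "1 \<le> real n ^ 3" using qn by (auto intro: one_le_power)
    then have "1 * 1 \<le> real q ^ 2 * real n ^ 3" by (intro mult_mono) auto
    then show "1 \<le> M" by (simp add: M_def)
    then show "0 < M" by simp
  qed
  have A1: "1 \<le> sum u Z" if "Z \<in> A" for Z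
    using that weight_ge_1[OF W strong] by (auto simp: A_def)
  have fl1: "1 \<le> fl Z" "real (fl Z) \<le> sum u Z" "sum u Z \<le> real (fl Z + 1)" if "Z \<in> A" for Z
    using A1[OF that] by (auto simp: fl_def le_nat_iff le_floor_iff) linarith
  have inner: "(\<Sum>Z\<in>{Z \<in> A. fl Z = j}. exp (- (ln M * sum u Z))) \<le> (1 / (8 * real n)) ^ j"
    if j: "j \<in> fl ` A" for j
  proof -
    have j1: "1 \<le> j" using j fl1 by auto
    have "card {Z \<in> A. fl Z = j}
        \<le> card {Z \<in> (\<lambda>Y. Y \<inter> W) ` {Y \<in> Supp. Y \<inter> {} = {}}. sum u Z \<le> real (j + 1)}"
      using finite_Supp fl1(3) by (intro card_mono) (auto simp: A_def)
    also have "\<dots> \<le> q ^ (j + 1) * (max (r W) (j + 1) choose (j + 1))"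
      using card_light_supports_le[OF W u strong, of "{}" "j + 1"] r_empty by simp
    also have "(max (r W) (j + 1) choose (j + 1)) \<le> n ^ (j + 1)"
    proof (cases "j + 1 \<le> r W")
      case True
      have "(r W choose (j + 1)) \<le> r W ^ (j + 1)" using True by (rule binomial_le_pow)
      also have "\<dots> \<le> n ^ (j + 1)" using n by (intro power_mono) auto
      finally show ?thesis using True by (simp add: max_def)
    next
      case False
      then show ?thesis using n by (simp add: max_def)
    qed
    finally have "card {Z \<in> A. fl Z = j} \<le> (q * n) ^ (j + 1)"
      using q_pos by (simp add: power_mult_distrib mult_ac)
    \<comment> \<open>Since \<open>j \<ge> 1\<close>, the exponent \<open>j + 1\<close>, which comes
      from rounding the weight up, is at most \<open>2 * j\<close>.\<close>
    also have "\<dots> \<le> (q * n) ^ (2 * j)" using j1 q_pos n by (intro power_increasing) auto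
    finally have "real (card {Z \<in> A. fl Z = j}) \<le> real ((q * n) ^ (2 * j))" by (simp only: of_nat_le_iff)
    then have cardle: "real (card {Z \<in> A. fl Z = j}) \<le> ((real q * real n) ^ 2) ^ j"
      by (simp add: power_mult)
    have "(\<Sum>Z\<in>{Z \<in> A. fl Z = j}. exp (- (ln M * sum u Z)))
        \<le> (\<Sum>Z\<in>{Z \<in> A. fl Z = j}. (1 / M) ^ j)"
    proof (rule sum_mono)
      fix Z assume Z: "Z \<in> {Z \<in> A. fl Z = j}"
      have "exp (- (ln M * sum u Z)) \<le> exp (- (ln M * real j))"
        using Z fl1(2)[of Z] M by (auto intro: mult_left_mono)
      also have "\<dots> = (1 / M) ^ j"
        using M by (simp add: exp_minus mult.commute exp_of_nat_mult power_one_over inverse_eq_divide)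
      finally show "exp (- (ln M * sum u Z)) \<le> (1 / M) ^ j" .
    qed
    also have "\<dots> = real (card {Z \<in> A. fl Z = j}) * (1 / M) ^ j" by simp
    also have "\<dots> \<le> ((real q * real n) ^ 2) ^ j * (1 / M) ^ j"
      using cardle M by (intro mult_right_mono) auto
    also have "\<dots> = ((real q * real n) ^ 2 / M) ^ j" by (simp add: power_mult_distrib[symmetric])
    also have "(real q * real n) ^ 2 / M = 1 / (8 * real n)"
      using qn by (simp add: M_def power2_eq_square power3_eq_cube field_simps)
    finally show ?thesis .
  qed
  have "(\<Sum>Z\<in>A. exp (- (ln M * sum u Z)))
      = (\<Sum>j\<in>fl ` A. \<Sum>Z\<in>{Z \<in> A. fl Z = j}. exp (- (ln M * sum u Z)))"
    using finA by (rule sum.image_gen)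
  also have "\<dots> \<le> (\<Sum>j\<in>fl ` A. (1 / (8 * real n)) ^ j)" by (intro sum_mono inner)
  also have "\<dots> \<le> 2 * (1 / (8 * real n))"
  proof (rule sum_powers_le_double)
    show "0 \<notin> fl ` A" using fl1(1) by force
    show "1 / (8 * real n) \<le> 1 / 2" using qn by (simp add: field_simps)
  qed (use finA in auto)
  finally show ?thesis by (simp add: A_def M_def)
qed

theorem exists_sparsifier:
  fixes n :: nat and \<epsilon> :: real
  assumes n: "r E \<le> n" "1 \<le> n" and eps: "0 < \<epsilon>" "\<epsilon> \<le> 1"
  shows "\<exists>T\<subseteq>E. \<exists>w. (\<forall>e\<in>E. 0 \<le> w e) \<and>
    real (card T) \<le> 16 * real n * ln (8 * real q ^ 2 * real n ^ 3) / \<epsilon>\<^sup>2 \<and>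
    (\<forall>Y\<in>Supp. \<bar>\<Sum>e\<in>Y. w e * of_bool (e \<in> T) - 1\<bar> \<le> \<epsilon> * real (card Y))"
proof -
  obtain \<kappa> :: "'a \<Rightarrow> real" where k1: "\<forall>e\<in>E. 0 < \<kappa> e" and k2: "(\<Sum>e\<in>E. 1 / \<kappa> e) = r E"
    and k3: "card (\<kappa> ` E) \<le> r E"
    and k5: "\<forall>\<theta>. \<forall>S\<subseteq>{e \<in> E. \<theta> \<le> \<kappa> e}.
       real (r {e \<in> E. \<theta> \<le> \<kappa> e}) - r S \<le> (\<Sum>e\<in>{e \<in> E. \<theta> \<le> \<kappa> e} - S. 1 / \<kappa> e)"
    using exists_strength[OF order_refl] by (elim exE conjE) (rule that)
  define u where "u e = 1 / \<kappa> e" for e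
  define W where "W \<theta> = {e \<in> E. \<theta> \<le> \<kappa> e}" for \<theta>
  define M where "M = 8 * real q ^ 2 * real n ^ 3"
  \<comment> \<open>Chosen so that \<open>\<epsilon>\<^sup>2 * L / 4\<close> is \<open>ln M\<close>,
    the rate in \<open>sum_exp_weight_le\<close>.\<close>
  define L where "L = 4 * ln M / \<epsilon>\<^sup>2"
  \<comment> \<open>Empty traces are left out, since each would contribute \<open>exp 0 = 1\<close>
    to the union bound.\<close>
  define J where "J = Sigma (\<kappa> ` E) (\<lambda>\<theta>. (\<lambda>Y. Y \<inter> W \<theta>) ` Supp - {{}})"
  have u: "0 < u e" if "e \<in> E" for e using k1 that by (simp add: u_def)
  have WE: "W \<theta> \<subseteq> E" for \<theta> by (auto simp: W_def)
  have strong: "real (r (W \<theta>)) - r S \<le> sum u (W \<theta> - S)" if "S \<subseteq> W \<theta>" for \<theta> S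
    using k5 that by (simp add: W_def u_def)
  have "1 \<le> real q ^ 2 * real n ^ 3"
  proof -
    have "1 \<le> real q ^ 2" "1 \<le> real n ^ 3" using q_pos n by (auto intro: one_le_power)
    then have "1 * 1 \<le> real q ^ 2 * real n ^ 3" by (intro mult_mono) auto
    then show ?thesis by simp
  qed
  then have "exp 1 \<le> M" using exp_le by (simp add: M_def)
  then have lnM: "1 \<le> ln M" using exp_gt_zero[of "1::real"] by (subst ln_ge_iff) linarith+
  then have L: "4 / \<epsilon>\<^sup>2 \<le> L" using eps by (simp add: L_def divide_right_mono)
  have L1: "1 \<le> L"
  proof -
    have "\<epsilon>\<^sup>2 \<le> 1" using eps by (simp add: power_le_one)
    then have "1 \<le> 4 / \<epsilon>\<^sup>2" using eps by (simp add: field_simps)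
    then show ?thesis using L by linarith
  qed
  have eL: "\<epsilon>\<^sup>2 * L / 4 = ln M" using eps by (simp add: L_def)
  have finJ: "finite J" using finite_E finite_Supp by (simp add: J_def)
  have "(\<Sum>j\<in>J. exp (- (ln M * sum u (snd j))))
      = (\<Sum>\<theta>\<in>\<kappa> ` E. \<Sum>Z\<in>(\<lambda>Y. Y \<inter> W \<theta>) ` Supp - {{}}. exp (- (ln M * sum u Z)))"
    unfolding J_def using finite_E finite_Supp by (subst sum.Sigma) (auto simp: case_prod_beta)
  also have "\<dots> \<le> (\<Sum>\<theta>\<in>\<kappa> ` E. 1 / (4 * real n))"
  proof (rule sum_mono)
    fix \<theta>
    have "r (W \<theta>) \<le> n" using r_mono[OF WE order_refl] n by (meson order_trans)
    then show "(\<Sum>Z\<in>(\<lambda>Y. Y \<inter> W \<theta>) ` Supp - {{}}. exp (- (ln M * sum u Z))) \<le> 1 / (4 * real n)"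
      unfolding M_def using u WE n strong
      by (intro sum_exp_weight_le) (auto simp: less_imp_le subset_iff)
  qed
  also have "\<dots> = real (card (\<kappa> ` E)) / (4 * real n)" by simp
  also have "\<dots> \<le> real n / (4 * real n)" using k3 n by (intro divide_right_mono) auto
  also have "\<dots> = 1 / 4" using n by simp
  finally have small: "(\<Sum>j\<in>J. exp (- (\<epsilon>\<^sup>2 * L / 4 * sum u (snd j)))) \<le> 1 / 4" by (simp add: eL)
  have "\<exists>T\<subseteq>E. \<exists>w. (\<forall>e\<in>E. 0 \<le> w e) \<and> real (card T) \<le> 4 * real n * L \<and>
    (\<forall>j\<in>J. \<bar>\<Sum>e\<in>snd j. u e * (w e * of_bool (e \<in> T) - 1)\<bar> \<le> \<epsilon> * sum u (snd j))"
  proof (rule importance_sampling[OF finite_E finJ u _ eps])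
    show "snd j \<subseteq> E" if "j \<in> J" for j using that by (auto simp: J_def W_def)
    show "0 < L" using L1 by simp
    show "sum u E \<le> real n" using k2 n by (simp add: u_def)
    show "1 \<le> real n * L" using mult_mono[of 1 "real n" 1 L] n L1 by simp
  qed (rule small | assumption)+
  then obtain T w where T: "T \<subseteq> E" "\<forall>e\<in>E. 0 \<le> w e" "real (card T) \<le> 4 * real n * L"
    and dev: "\<forall>j\<in>J. \<bar>\<Sum>e\<in>snd j. u e * (w e * of_bool (e \<in> T) - 1)\<bar> \<le> \<epsilon> * sum u (snd j)"
    by blast
  have "s * (\<Sum>e\<in>Y. w e * of_bool (e \<in> T) - 1) \<le> \<epsilon> * real (card Y)"
    if Y: "Y \<in> Supp" and s: "s \<in> {1, -1}" for Y and s :: real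
  proof -
    have YE: "Y \<subseteq> E" using Y Union_Supp by auto
    \<comment> \<open>The factor \<open>\<kappa> e\<close> cancels \<open>u e\<close>, so Abel
      summation turns the weighted bounds on superlevel sets into the unweighted bound on
      \<open>Y\<close>.\<close>
    have "0 \<le> (\<Sum>e\<in>Y. \<kappa> e * (\<epsilon> * u e - s * (u e * (w e * of_bool (e \<in> T) - 1))))"
    proof (rule sum_mult_nonneg_if_superlevel_sums_nonneg)
      show "finite Y" using finite_subset_E[OF YE] .
      show "0 \<le> \<kappa> e" if "e \<in> Y" for e using that k1 YE by (auto simp: less_imp_le)
      fix \<theta> assume \<theta>: "\<theta> \<in> \<kappa> ` Y"
      have eq: "{e \<in> Y. \<theta> \<le> \<kappa> e} = Y \<inter> W \<theta>" using YE by (auto simp: W_def)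
      have "Y \<inter> W \<theta> \<noteq> {}" using \<theta> YE by (auto simp: W_def)
      then have "(\<theta>, Y \<inter> W \<theta>) \<in> J" using \<theta> Y YE by (auto simp: J_def)
      then have "\<bar>\<Sum>e\<in>Y \<inter> W \<theta>. u e * (w e * of_bool (e \<in> T) - 1)\<bar> \<le> \<epsilon> * sum u (Y \<inter> W \<theta>)"
        using dev by fastforce
      then have "s * (\<Sum>e\<in>Y \<inter> W \<theta>. u e * (w e * of_bool (e \<in> T) - 1)) \<le> \<epsilon> * sum u (Y \<inter> W \<theta>)"
        using s by auto
      then show "0 \<le> (\<Sum>e\<in>{e \<in> Y. \<theta> \<le> \<kappa> e}. \<epsilon> * u e - s * (u e * (w e * of_bool (e \<in> T) - 1)))"
        unfolding eq by (simp add: sum_subtractf sum_distrib_left)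
    qed
    also have "\<dots> = (\<Sum>e\<in>Y. \<epsilon> - s * (w e * of_bool (e \<in> T) - 1))"
    proof (rule sum.cong)
      fix e assume "e \<in> Y"
      then have "0 < \<kappa> e" using k1 YE by auto
      then have 1: "\<kappa> e * u e = 1" by (simp add: u_def)
      have "\<kappa> e * (\<epsilon> * u e - s * (u e * b)) = \<kappa> e * u e * (\<epsilon> - s * b)" for b
        by (simp add: algebra_simps)
      then show "\<kappa> e * (\<epsilon> * u e - s * (u e * (w e * of_bool (e \<in> T) - 1)))
          = \<epsilon> - s * (w e * of_bool (e \<in> T) - 1)"
        by (simp only: 1 mult_1)
    qed simp
    also have "\<dots> = \<epsilon> * real (card Y) - s * (\<Sum>e\<in>Y. w e * of_bool (e \<in> T) - 1)"
      by (simp only: sum_subtractf[of "\<lambda>_. \<epsilon>"] sum_constant sum_distrib_left mult.commute)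
    finally show ?thesis by simp
  qed
  from this[of _ 1] this[of _ "-1"]
  have "\<forall>Y\<in>Supp. \<bar>\<Sum>e\<in>Y. w e * of_bool (e \<in> T) - 1\<bar> \<le> \<epsilon> * real (card Y)" by (auto simp: abs_le_iff)
  moreover have "4 * real n * L = 16 * real n * ln M / \<epsilon>\<^sup>2" by (simp add: L_def)
  ultimately show ?thesis using T unfolding M_def by auto
qed

end

section \<open>Linear functionals over a finite field\<close>

lemma card_eq_fibre_mult_image:
  assumes "finite A" and "\<And>x. x \<in> A \<Longrightarrow> card {y \<in> A. g y = g x} = c"
  shows "card A = c * card (g ` A)"
proof -
  have "card A = (\<Sum>b\<in>g ` A. card {y \<in> A. g y = b})"
    using sum.image_gen[OF assms(1), of "\<lambda>_. 1::nat" g] by simp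
  also have "\<dots> = (\<Sum>b\<in>g ` A. c)" using assms(2) by (intro sum.cong) auto
  finally show ?thesis by simp
qed

text \<open>Vectors are extensional functions on \<open>I\<close>, so there are finitely many and
  they can be counted. Excluding zero functionals makes the supports cover \<open>E\<close>, as
  \<open>support_matroid\<close> demands.\<close>

locale nonzero_functionals = field R for R (structure) +
  fixes I :: "'i set" and E :: "'e set" and \<phi> :: "'e \<Rightarrow> ('i \<Rightarrow> 'a) \<Rightarrow> 'a"
  assumes finite_carrier: "finite (carrier R)" and finite_I: "finite I" and finite_E: "finite E"
    and \<phi>_closed: "\<lbrakk>e \<in> E; x \<in> I \<rightarrow>\<^sub>E carrier R\<rbrakk> \<Longrightarrow> \<phi> e x \<in> carrier R"
    and \<phi>_add: "\<lbrakk>e \<in> E; x \<in> I \<rightarrow>\<^sub>E carrier R; y \<in> I \<rightarrow>\<^sub>E carrier R\<rbrakk>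
      \<Longrightarrow> \<phi> e (\<lambda>i\<in>I. x i \<oplus> y i) = \<phi> e x \<oplus> \<phi> e y"
    and \<phi>_smult: "\<lbrakk>e \<in> E; c \<in> carrier R; x \<in> I \<rightarrow>\<^sub>E carrier R\<rbrakk>
      \<Longrightarrow> \<phi> e (\<lambda>i\<in>I. c \<otimes> x i) = c \<otimes> \<phi> e x"
    and \<phi>_nonzero: "e \<in> E \<Longrightarrow> \<exists>x\<in>I \<rightarrow>\<^sub>E carrier R. \<phi> e x \<noteq> \<zero>"
begin

definition X :: "('i \<Rightarrow> 'a) set" where "X = I \<rightarrow>\<^sub>E carrier R"

definition q :: nat where "q = card (carrier R)"

definition zeros :: "'e set \<Rightarrow> ('i \<Rightarrow> 'a) set" where
  "zeros S = {x \<in> X. \<forall>e\<in>S. \<phi> e x = \<zero>}"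

definition supp :: "('i \<Rightarrow> 'a) \<Rightarrow> 'e set" where
  "supp x = {e \<in> E. \<phi> e x \<noteq> \<zero>}"

text \<open>The codimension of the common zero space, read off from cardinalities instead of from a
  basis.\<close>

definition rk :: "'e set \<Rightarrow> nat" where
  "rk S = (THE d. card (zeros S) * q ^ d = card X)"

lemma q_ge_2: "2 \<le> q"
proof -
  have "card {\<zero>, \<one>} \<le> q" unfolding q_def using finite_carrier by (intro card_mono) auto
  then show ?thesis by simp
qed

lemma X_closed: "x \<in> X \<Longrightarrow> i \<in> I \<Longrightarrow> x i \<in> carrier R"
  by (auto simp: X_def)

lemma finite_X: "finite X"
  unfolding X_def using finite_I finite_carrier by (intro finite_PiE) auto

lemma finite_zeros: "finite (zeros S)"
  using finite_X by (simp add: zeros_def)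

lemma minus_closed_X: "\<lbrakk>x \<in> X; y \<in> X\<rbrakk> \<Longrightarrow> (\<lambda>i\<in>I. x i \<ominus> y i) \<in> X"
  by (auto simp: X_def PiE_iff)

lemma add_closed_X: "\<lbrakk>x \<in> X; y \<in> X\<rbrakk> \<Longrightarrow> (\<lambda>i\<in>I. x i \<oplus> y i) \<in> X"
  by (auto simp: X_def PiE_iff)

lemma smult_closed_X: "\<lbrakk>c \<in> carrier R; x \<in> X\<rbrakk> \<Longrightarrow> (\<lambda>i\<in>I. c \<otimes> x i) \<in> X"
  by (auto simp: X_def PiE_iff)

lemma \<phi>_minus:
  assumes e: "e \<in> E" and x: "x \<in> X" and y: "y \<in> X"
  shows "\<phi> e (\<lambda>i\<in>I. x i \<ominus> y i) = \<phi> e x \<ominus> \<phi> e y"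
proof -
  have "(\<lambda>i\<in>I. x i \<ominus> y i) = (\<lambda>i\<in>I. x i \<oplus> (\<lambda>i\<in>I. (\<ominus> \<one>) \<otimes> y i) i)"
    using x y by (intro restrict_ext) (simp add: X_closed a_minus_def l_minus)
  then have "\<phi> e (\<lambda>i\<in>I. x i \<ominus> y i) = \<phi> e (\<lambda>i\<in>I. x i \<oplus> (\<lambda>i\<in>I. (\<ominus> \<one>) \<otimes> y i) i)"
    by (rule arg_cong)
  also have "\<dots> = \<phi> e x \<oplus> \<phi> e (\<lambda>i\<in>I. (\<ominus> \<one>) \<otimes> y i)"
    using x y smult_closed_X[of "\<ominus> \<one>" y] unfolding X_def by (intro \<phi>_add e) auto
  also have "\<phi> e (\<lambda>i\<in>I. (\<ominus> \<one>) \<otimes> y i) = (\<ominus> \<one>) \<otimes> \<phi> e y"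
    using y unfolding X_def by (intro \<phi>_smult e) auto
  also have "\<phi> e x \<oplus> (\<ominus> \<one>) \<otimes> \<phi> e y = \<phi> e x \<ominus> \<phi> e y"
    using \<phi>_closed[OF e] y by (simp add: X_def a_minus_def l_minus)
  finally show ?thesis .
qed

lemma zero_in_zeros:
  assumes "S \<subseteq> E"
  shows "(\<lambda>i\<in>I. \<zero>) \<in> zeros S"
proof -
  have z: "(\<lambda>i\<in>I. \<zero>) \<in> X" by (auto simp: X_def)
  have "\<phi> e (\<lambda>i\<in>I. \<zero>) = \<zero>" if e: "e \<in> E" for e
  proof -
    have "\<phi> e (\<lambda>i\<in>I. \<zero> \<otimes> (\<lambda>i\<in>I. \<zero>) i) = \<zero> \<otimes> \<phi> e (\<lambda>i\<in>I. \<zero>)"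
      using z by (intro \<phi>_smult e) (auto simp: X_def)
    moreover have "(\<lambda>i\<in>I. \<zero> \<otimes> (\<lambda>i\<in>I. \<zero>) i) = (\<lambda>i\<in>I. \<zero>)" by (intro restrict_ext) simp
    ultimately show ?thesis using \<phi>_closed[OF e] z by (simp add: X_def)
  qed
  then show ?thesis using z assms by (auto simp: zeros_def)
qed

lemma card_zeros_pos: "S \<subseteq> E \<Longrightarrow> 0 < card (zeros S)"
  using zero_in_zeros finite_zeros by (auto simp: card_gt_0_iff)

text \<open>The fibre of \<open>g\<close> through \<open>x\<close> is the translate of
  \<open>zeros W\<close> by \<open>x\<close>, so all fibres have equal size. It serves for
  evaluation at one functional and for restriction of words to \<open>W\<close>.\<close>

lemma card_zeros_factor:
  assumes SW: "S \<subseteq> W" "W \<subseteq> E"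
    and g: "\<And>x y. \<lbrakk>x \<in> zeros S; y \<in> zeros S\<rbrakk> \<Longrightarrow> g x = g y \<longleftrightarrow> (\<forall>e\<in>W. \<phi> e x = \<phi> e y)"
  shows "card (zeros S) = card (zeros W) * card (g ` zeros S)"
proof (rule card_eq_fibre_mult_image[OF finite_zeros])
  fix x assume x: "x \<in> zeros S"
  then have xX: "x \<in> X" by (simp add: zeros_def)
  have c: "\<phi> e y \<in> carrier R" if "e \<in> W" "y \<in> X" for e y
    using that SW \<phi>_closed[of e y] by (auto simp: X_def)
  have "bij_betw (\<lambda>y. \<lambda>i\<in>I. y i \<ominus> x i) {y \<in> zeros S. g y = g x} (zeros W)"
  proof (rule bij_betw_byWitness[where f' = "\<lambda>z. \<lambda>i\<in>I. z i \<oplus> x i"])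
    show "\<forall>y\<in>{y \<in> zeros S. g y = g x}. (\<lambda>i\<in>I. (\<lambda>i\<in>I. y i \<ominus> x i) i \<oplus> x i) = y"
    proof
      fix y assume "y \<in> {y \<in> zeros S. g y = g x}"
      then have y: "y \<in> X" by (simp add: zeros_def)
      have "(\<lambda>i\<in>I. (\<lambda>i\<in>I. y i \<ominus> x i) i \<oplus> x i) = restrict y I"
        using y xX by (intro restrict_ext) (simp add: X_closed a_minus_def a_assoc l_neg)
      also have "\<dots> = y" using y by (auto simp: X_def)
      finally show "(\<lambda>i\<in>I. (\<lambda>i\<in>I. y i \<ominus> x i) i \<oplus> x i) = y" .
    qed
    show "\<forall>z\<in>zeros W. (\<lambda>i\<in>I. (\<lambda>i\<in>I. z i \<oplus> x i) i \<ominus> x i) = z"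
    proof
      fix z assume "z \<in> zeros W"
      then have z: "z \<in> X" by (simp add: zeros_def)
      have "(\<lambda>i\<in>I. (\<lambda>i\<in>I. z i \<oplus> x i) i \<ominus> x i) = restrict z I"
        using z xX by (intro restrict_ext) (simp add: X_closed a_minus_def a_assoc r_neg)
      also have "\<dots> = z" using z by (auto simp: X_def)
      finally show "(\<lambda>i\<in>I. (\<lambda>i\<in>I. z i \<oplus> x i) i \<ominus> x i) = z" .
    qed
    show "(\<lambda>y. \<lambda>i\<in>I. y i \<ominus> x i) ` {y \<in> zeros S. g y = g x} \<subseteq> zeros W"
    proof clarify
      fix y assume y: "y \<in> zeros S" "g y = g x"
      then have yX: "y \<in> X" by (simp add: zeros_def)
      have "\<phi> e (\<lambda>i\<in>I. y i \<ominus> x i) = \<zero>" if e: "e \<in> W" for e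
      proof -
        have "\<phi> e y = \<phi> e x" using g[OF y(1) x] y e by auto
        then show ?thesis using \<phi>_minus[of e y x] e SW yX xX c[OF e xX] by (auto simp: r_neg a_minus_def)
      qed
      then show "(\<lambda>i\<in>I. y i \<ominus> x i) \<in> zeros W" using minus_closed_X[OF yX xX] by (simp add: zeros_def)
    qed
    show "(\<lambda>z. \<lambda>i\<in>I. z i \<oplus> x i) ` zeros W \<subseteq> {y \<in> zeros S. g y = g x}"
    proof clarify
      fix z assume z: "z \<in> zeros W"
      then have zX: "z \<in> X" by (simp add: zeros_def)
      have eq: "\<phi> e (\<lambda>i\<in>I. z i \<oplus> x i) = \<phi> e x" if e: "e \<in> W" for e
        using \<phi>_add[of e z x] e SW z zX xX c[OF e xX] by (auto simp: zeros_def X_def)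
      then have inS: "(\<lambda>i\<in>I. z i \<oplus> x i) \<in> zeros S"
        using add_closed_X[OF zX xX] x SW by (auto simp: zeros_def)
      then show "(\<lambda>i\<in>I. z i \<oplus> x i) \<in> zeros S \<and> g (\<lambda>i\<in>I. z i \<oplus> x i) = g x"
        using g[OF inS x] eq by auto
    qed
  qed
  then show "card {y \<in> zeros S. g y = g x} = card (zeros W)" by (rule bij_betw_same_card)
qed

text \<open>The scalar multiples of \<open>x\<close> stay in \<open>zeros S\<close> and already take
  every value under \<open>\<phi> e\<close>, so there are \<open>q\<close> fibres.\<close>

lemma card_zeros_insert:
  assumes S: "S \<subseteq> E" and e: "e \<in> E" and x: "x \<in> zeros S" "\<phi> e x \<noteq> \<zero>"
  shows "card (zeros S) = card (zeros (insert e S)) * q"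
proof -
  have xX: "x \<in> X" using x by (simp add: zeros_def)
  have ex: "\<phi> e x \<in> Units R" using x xX \<phi>_closed[OF e] by (auto simp: field_Units X_def)
  have "\<phi> e ` zeros S = carrier R"
  proof
    show "\<phi> e ` zeros S \<subseteq> carrier R" using \<phi>_closed[OF e] by (auto simp: zeros_def X_def)
    show "carrier R \<subseteq> \<phi> e ` zeros S"
    proof
      fix c assume c: "c \<in> carrier R"
      define b where "b = c \<otimes> inv (\<phi> e x)"
      have b: "b \<in> carrier R" using c ex by (simp add: b_def)
      have "(\<lambda>i\<in>I. b \<otimes> x i) \<in> zeros S"
        using smult_closed_X[OF b xX] \<phi>_smult[OF _ b] xX x S b by (auto simp: zeros_def X_def)
      moreover have "\<phi> e (\<lambda>i\<in>I. b \<otimes> x i) = c"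
        using \<phi>_smult[OF e b] xX c ex by (simp add: X_def b_def m_assoc Units_closed)
      ultimately show "c \<in> \<phi> e ` zeros S" by (metis image_eqI)
    qed
  qed
  moreover have "card (zeros S) = card (zeros (insert e S)) * card (\<phi> e ` zeros S)"
    using S e by (intro card_zeros_factor) (auto simp: zeros_def)
  ultimately show ?thesis by (simp add: q_def)
qed

lemma zeros_insert_eq: "\<forall>x\<in>zeros S. \<phi> e x = \<zero> \<Longrightarrow> zeros (insert e S) = zeros S"
  by (auto simp: zeros_def)

lemma rk_eqI:
  assumes "S \<subseteq> E" "card (zeros S) * q ^ d = card X"
  shows "rk S = d"
  unfolding rk_def
proof (rule the_equality)
  fix d' assume "card (zeros S) * q ^ d' = card X"
  with assms(2) have "card (zeros S) * q ^ d' = card (zeros S) * q ^ d" by simp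
  then show "d' = d" using card_zeros_pos[OF assms(1)] q_ge_2 by simp
qed fact

lemma card_zeros_mult_rk: "S \<subseteq> E \<Longrightarrow> card (zeros S) * q ^ rk S = card X"
proof -
  assume SE: "S \<subseteq> E"
  have "finite S" using SE finite_E finite_subset by blast
  \<comment> \<open>Adding a functional either leaves the common zeros unchanged or divides their
    number by \<open>q\<close>.\<close>
  then have "\<exists>d. card (zeros S) * q ^ d = card X" using SE
  proof (induction S rule: finite_induct)
    case empty
    show ?case by (intro exI[of _ 0]) (simp add: zeros_def)
  next
    case (insert e S)
    then obtain d where d: "card (zeros S) * q ^ d = card X" by auto
    show ?case
    proof (cases "\<forall>x\<in>zeros S. \<phi> e x = \<zero>")
      case True
      then show ?thesis using d zeros_insert_eq by metis
    next
      case False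
      then have "card (zeros S) = card (zeros (insert e S)) * q"
        using insert.prems card_zeros_insert by auto
      then show ?thesis using d by (intro exI[of _ "Suc d"]) (simp add: mult_ac)
    qed
  qed
  then show ?thesis using rk_eqI[OF SE] by auto
qed

lemma rk_insert:
  assumes "S \<subseteq> E" "e \<in> E"
  shows "rk (insert e S) = (if \<forall>x\<in>zeros S. \<phi> e x = \<zero> then rk S else Suc (rk S))"
proof (cases "\<forall>x\<in>zeros S. \<phi> e x = \<zero>")
  case True
  then show ?thesis by (simp add: rk_def zeros_insert_eq)
next
  case False
  then have "card (zeros S) = card (zeros (insert e S)) * q" using assms card_zeros_insert by auto
  then have "rk (insert e S) = Suc (rk S)"
    using assms card_zeros_mult_rk[of S] by (intro rk_eqI) (auto simp: mult_ac)
  then show ?thesis using False by auto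
qed

lemma rk_le_card: "rk E \<le> card I"
proof -
  have "q ^ rk E \<le> card (zeros E) * q ^ rk E" using card_zeros_pos[of E] by simp
  also have "\<dots> = q ^ card I"
    using card_zeros_mult_rk[of E] finite_I by (simp add: X_def q_def card_PiE)
  finally show ?thesis using q_ge_2 by simp
qed

lemma supports_disjoint: "S \<subseteq> E \<Longrightarrow> {Y \<in> supp ` X. Y \<inter> S = {}} = supp ` zeros S"
  by (auto simp: supp_def zeros_def)

text \<open>A trace on \<open>W\<close> is determined by the values of the functionals in
  \<open>W\<close>, and on \<open>zeros S\<close> exactly \<open>q ^ (rk W - rk S)\<close> value
  patterns occur.\<close>

lemma card_restricted_supports:
  assumes "S \<subseteq> W" "W \<subseteq> E"
  shows "card ((\<lambda>Y. Y \<inter> W) ` {Y \<in> supp ` X. Y \<inter> S = {}}) \<le> q ^ (rk W - rk S)"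
proof -
  define g where "g x = (\<lambda>e\<in>W. \<phi> e x)" for x
  have SE: "S \<subseteq> E" using assms by auto
  have "(\<lambda>Y. Y \<inter> W) ` supp ` zeros S = (\<lambda>h. {e \<in> W. h e \<noteq> \<zero>}) ` g ` zeros S"
    unfolding image_image using assms by (intro image_cong) (auto simp: supp_def g_def)
  then have 1: "card ((\<lambda>Y. Y \<inter> W) ` {Y \<in> supp ` X. Y \<inter> S = {}}) \<le> card (g ` zeros S)"
    unfolding supports_disjoint[OF SE] using finite_zeros by (simp add: card_image_le)
  have "card (zeros S) = card (zeros W) * card (g ` zeros S)"
  proof (rule card_zeros_factor[OF assms])
    fix x y
    show "g x = g y \<longleftrightarrow> (\<forall>e\<in>W. \<phi> e x = \<phi> e y)"
      unfolding g_def fun_eq_iff restrict_def by auto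
  qed
  then have "card (zeros W) * (card (g ` zeros S) * q ^ rk S) = card (zeros W) * q ^ rk W"
    using card_zeros_mult_rk[OF SE] card_zeros_mult_rk[OF assms(2)] by (simp add: mult_ac)
  then have eq: "card (g ` zeros S) * q ^ rk S = q ^ rk W"
    using card_zeros_pos[OF assms(2)] by simp
  have "g ` zeros S \<noteq> {}" using zero_in_zeros[OF SE] by auto
  then have "1 \<le> card (g ` zeros S)" using finite_zeros by (simp add: Suc_le_eq card_gt_0_iff)
  then have "q ^ rk S \<le> card (g ` zeros S) * q ^ rk S" by simp
  then have "q ^ rk S \<le> q ^ rk W" using eq by simp
  then have "rk S \<le> rk W" using q_ge_2 by simp
  then have "card (g ` zeros S) * q ^ rk S = q ^ (rk W - rk S) * q ^ rk S"
    using eq by (simp add: power_add[symmetric])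
  then show ?thesis using 1 q_ge_2 by simp
qed

sublocale support_matroid E "supp ` X" rk q
proof
  show "\<Union> (supp ` X) = E" using \<phi>_nonzero by (auto simp: supp_def X_def)
  show "1 \<le> q" using q_ge_2 by simp
  show "rk {} = 0" by (rule rk_eqI) (auto simp: zeros_def)
  fix S e assume S: "S \<subseteq> E" and e: "e \<in> E"
  have "(\<forall>x\<in>zeros S. \<phi> e x = \<zero>) \<longleftrightarrow> (\<forall>Y\<in>supp ` zeros S. e \<notin> Y)" using e by (auto simp: supp_def)
  also have "\<dots> \<longleftrightarrow> (\<forall>Y\<in>supp ` X. Y \<inter> S = {} \<longrightarrow> e \<notin> Y)"
    unfolding supports_disjoint[OF S, symmetric] by blast
  finally show "rk (insert e S) =
      (if \<forall>Y\<in>supp ` X. Y \<inter> S = {} \<longrightarrow> e \<notin> Y then rk S else Suc (rk S))"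
    using rk_insert[OF S e] by simp
qed (use finite_E card_restricted_supports in auto)

end

section \<open>Homogenisation of affine constraints and the final size bound\<close>

lemma affine_constraints_sparsifier:
  fixes R :: "('a, 'b) ring_scheme" (structure) and \<epsilon> :: real and m k :: nat
  assumes R: "field R" "finite (carrier R)" and eps: "0 < \<epsilon>" "\<epsilon> \<le> 1"
    and P: "\<And>j. j < m \<Longrightarrow> affine_pred R (r j) (P j)" and idx: "\<And>j i. \<lbrakk>j < m; i < r j\<rbrakk> \<Longrightarrow> idx j i < k"
  shows "\<exists>T w. T \<subseteq> {..<m} \<and> (\<forall>j\<in>T. 0 \<le> w j) \<and>
    real (card T) \<le> 16 * real (k + 1) * ln (8 * real (card (carrier R)) ^ 2 * real (k + 1) ^ 3) / \<epsilon>\<^sup>2 \<and>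
    (\<forall>x. (\<forall>i<k. x i \<in> carrier R) \<longrightarrow>
      \<bar>(\<Sum>j\<in>T. w j * constr_val R (r j) (P j) (idx j) x) - (\<Sum>j<m. constr_val R (r j) (P j) (idx j) x)\<bar>
        \<le> \<epsilon> * (\<Sum>j<m. constr_val R (r j) (P j) (idx j) x))"
proof -
  interpret field R by (rule R)
  define Q where "Q j a0 a \<longleftrightarrow> a0 \<in> carrier R \<and> (\<forall>i<r j. a i \<in> carrier R) \<and>
        (\<forall>b. (\<forall>i<r j. b i \<in> carrier R) \<longrightarrow>
          (\<not> P j b \<longleftrightarrow> a0 \<oplus> finsum R (\<lambda>i. a i \<otimes> b i) {..<r j} = \<zero>))" for j a0 a
  have "\<exists>a0 a. Q j a0 a" if "j < m" for j
    using P[OF that] unfolding affine_pred_def Q_def Bex_def by simp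
  then obtain a0 a where Q: "\<And>j. j < m \<Longrightarrow> Q j (a0 j) (a j)" by metis
  have a0: "a0 j \<in> carrier R" if "j < m" for j using Q[OF that] by (simp add: Q_def)
  have a: "a j i \<in> carrier R" if "j < m" "i < r j" for j i using Q[OF that(1)] that(2) by (simp add: Q_def)
  have Pa: "\<not> P j b \<longleftrightarrow> a0 j \<oplus> finsum R (\<lambda>i. a j i \<otimes> b i) {..<r j} = \<zero>"
    if "j < m" "\<And>i. i < r j \<Longrightarrow> b i \<in> carrier R" for j b
    using Q[OF that(1)] that(2) by (simp add: Q_def)
  text \<open>The coordinate \<open>k\<close> homogenises the affine forms.\<close>
  define \<phi> where "\<phi> j x = a0 j \<otimes> x k \<oplus> finsum R (\<lambda>i. a j i \<otimes> x (idx j i)) {..<r j}" for j x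
  \<comment> \<open>A constraint whose functional vanishes identically is never satisfied, so
    dropping it changes no value.\<close>
  define E where "E = {j. j < m \<and> (\<exists>x\<in>{..k} \<rightarrow>\<^sub>E carrier R. \<phi> j x \<noteq> \<zero>)}"
  have XD: "x i \<in> carrier R" if "x \<in> {..k} \<rightarrow>\<^sub>E carrier R" "i \<le> k" for x i using that by auto
  have idx': "idx j i \<le> k" if "j < m" "i < r j" for j i using idx[OF that] by simp
  have cl: "\<phi> j x \<in> carrier R" if "j < m" "x \<in> {..k} \<rightarrow>\<^sub>E carrier R" for j x
    unfolding \<phi>_def using a0 a XD idx' that by (auto intro!: finsum_closed)
  have add: "\<phi> j (\<lambda>i\<in>{..k}. x i \<oplus> y i) = \<phi> j x \<oplus> \<phi> j y"
    if j: "j < m" and x: "x \<in> {..k} \<rightarrow>\<^sub>E carrier R" and y: "y \<in> {..k} \<rightarrow>\<^sub>E carrier R" for j x y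
  proof -
    note cl = a0[OF j] a[OF j] XD[OF x] XD[OF y] idx'[OF j]
    have "finsum R (\<lambda>i. a j i \<otimes> (\<lambda>i\<in>{..k}. x i \<oplus> y i) (idx j i)) {..<r j}
        = finsum R (\<lambda>i. a j i \<otimes> x (idx j i) \<oplus> a j i \<otimes> y (idx j i)) {..<r j}"
      using cl by (intro finsum_cong') (auto simp: r_distr)
    also have "\<dots> = finsum R (\<lambda>i. a j i \<otimes> x (idx j i)) {..<r j} \<oplus> finsum R (\<lambda>i. a j i \<otimes> y (idx j i)) {..<r j}"
      using cl by (intro finsum_addf) auto
    finally show ?thesis
      unfolding \<phi>_def using cl by (simp add: r_distr a_ac finsum_closed Pi_def)
  qed
  have smult: "\<phi> j (\<lambda>i\<in>{..k}. c \<otimes> x i) = c \<otimes> \<phi> j x"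
    if j: "j < m" and c: "c \<in> carrier R" and x: "x \<in> {..k} \<rightarrow>\<^sub>E carrier R" for j c x
  proof -
    note cl = a0[OF j] a[OF j] XD[OF x] idx'[OF j] c
    have "finsum R (\<lambda>i. a j i \<otimes> (\<lambda>i\<in>{..k}. c \<otimes> x i) (idx j i)) {..<r j}
        = finsum R (\<lambda>i. c \<otimes> (a j i \<otimes> x (idx j i))) {..<r j}"
      using cl by (intro finsum_cong') (auto simp: m_lcomm)
    also have "\<dots> = c \<otimes> finsum R (\<lambda>i. a j i \<otimes> x (idx j i)) {..<r j}"
      using cl by (intro finsum_rdistr[symmetric]) auto
    finally show ?thesis
      unfolding \<phi>_def using cl by (simp add: r_distr m_lcomm finsum_closed Pi_def)
  qed
  interpret nonzero_functionals R "{..k}" E \<phi>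
  proof unfold_locales
    show "finite E" by (rule finite_subset[of _ "{..<m}"]) (auto simp: E_def)
    fix j assume j: "j \<in> E"
    then have jm: "j < m" by (simp add: E_def)
    show "\<exists>x\<in>{..k} \<rightarrow>\<^sub>E carrier R. \<phi> j x \<noteq> \<zero>" using j by (simp add: E_def)
    fix x assume x: "x \<in> {..k} \<rightarrow>\<^sub>E carrier R"
    show "\<phi> j x \<in> carrier R" using jm x by (rule cl)
    show "\<phi> j (\<lambda>i\<in>{..k}. x i \<oplus> y i) = \<phi> j x \<oplus> \<phi> j y"
      if "y \<in> {..k} \<rightarrow>\<^sub>E carrier R" for y using jm x that by (rule add)
    show "\<phi> j (\<lambda>i\<in>{..k}. c \<otimes> x i) = c \<otimes> \<phi> j x" if "c \<in> carrier R" for c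
      using jm that x by (rule smult)
  qed (use R in auto)
  have rk: "rk E \<le> k + 1" using rk_le_card by simp
  obtain T w where T: "T \<subseteq> E" "\<forall>j\<in>E. 0 \<le> w j"
      "real (card T) \<le> 16 * real (k + 1) * ln (8 * real q ^ 2 * real (k + 1) ^ 3) / \<epsilon>\<^sup>2"
    and dev: "\<forall>Y\<in>supp ` X. \<bar>\<Sum>j\<in>Y. w j * of_bool (j \<in> T) - 1\<bar> \<le> \<epsilon> * real (card Y)"
    using exists_sparsifier[OF rk le_add2 eps] by blast
  have "\<bar>(\<Sum>j\<in>T. w j * constr_val R (r j) (P j) (idx j) x) - (\<Sum>j<m. constr_val R (r j) (P j) (idx j) x)\<bar>
        \<le> \<epsilon> * (\<Sum>j<m. constr_val R (r j) (P j) (idx j) x)" if x: "\<forall>i<k. x i \<in> carrier R" for x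
  proof -
    \<comment> \<open>Setting the extra coordinate to \<open>\<one>\<close> recovers the affine
      forms, so the satisfied constraints are exactly \<open>supp x'\<close>.\<close>
    define x' where "x' = (\<lambda>i\<in>{..k}. if i < k then x i else \<one>)"
    have x': "x' \<in> {..k} \<rightarrow>\<^sub>E carrier R" using x by (auto simp: x'_def)
    have val: "constr_val R (r j) (P j) (idx j) x = of_bool (j \<in> supp x')" if j: "j < m" for j
    proof -
      let ?b = "\<lambda>i. if i < r j then x (idx j i) else \<zero>"
      have "finsum R (\<lambda>i. a j i \<otimes> x' (idx j i)) {..<r j} = finsum R (\<lambda>i. a j i \<otimes> ?b i) {..<r j}"
        using a[OF j] x idx[OF j] by (intro finsum_cong') (auto simp: x'_def less_imp_le)
      then have "\<phi> j x' = a0 j \<oplus> finsum R (\<lambda>i. a j i \<otimes> ?b i) {..<r j}"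
        using a0[OF j] by (simp add: \<phi>_def x'_def)
      then have "P j ?b \<longleftrightarrow> \<phi> j x' \<noteq> \<zero>" using Pa[OF j, of ?b] x idx[OF j] by auto
      also have "\<dots> \<longleftrightarrow> j \<in> E \<and> \<phi> j x' \<noteq> \<zero>" using j x' unfolding E_def by blast
      also have "\<dots> \<longleftrightarrow> j \<in> supp x'" by (simp add: supp_def)
      finally show ?thesis by (simp add: constr_val_def)
    qed
    have "supp x' \<subseteq> E" by (auto simp: supp_def)
    moreover have "E \<subseteq> {..<m}" by (auto simp: E_def)
    ultimately have sub: "supp x' \<subseteq> {..<m}" "T \<subseteq> {..<m}" using T(1) by auto
    have finT: "finite T" using sub finite_subset by blast
    have tot: "(\<Sum>j<m. constr_val R (r j) (P j) (idx j) x) = real (card (supp x'))"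
      using sub val by (simp add: Int_absorb1)
    have "(\<Sum>j\<in>T. w j * constr_val R (r j) (P j) (idx j) x) = (\<Sum>j\<in>T. if j \<in> supp x' then w j else 0)"
      using sub val by (intro sum.cong) auto
    also have "\<dots> = (\<Sum>j\<in>supp x'. if j \<in> T then w j else 0)"
      using sub finT finite_subset[OF sub(1)] by (simp add: sum.inter_restrict[symmetric] Int_commute)
    also have "\<dots> = (\<Sum>j\<in>supp x'. w j * of_bool (j \<in> T))" by (intro sum.cong) auto
    finally have "(\<Sum>j\<in>T. w j * constr_val R (r j) (P j) (idx j) x)
        - (\<Sum>j<m. constr_val R (r j) (P j) (idx j) x) = (\<Sum>j\<in>supp x'. w j * of_bool (j \<in> T) - 1)"
      by (simp add: tot sum_subtractf)
    then show ?thesis using dev x' by (simp add: tot X_def)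
  qed
  moreover have "T \<subseteq> {..<m}" using T(1) by (auto simp: E_def)
  ultimately show ?thesis using T unfolding q_def by (intro exI[of _ T] exI[of _ w]) auto
qed

text \<open>\<open>4 * k / \<epsilon>\<close> is at least 2 and at least \<open>k\<close>, so its
  binary logarithm dominates both 1 and \<open>ln k\<close> and absorbs the constant and the three
  copies of \<open>ln k\<close>.\<close>

lemma ln_size_bound:
  fixes q \<epsilon> :: real and k :: nat
  assumes q: "1 \<le> q" and k: "1 \<le> k" and eps: "0 < \<epsilon>" "\<epsilon> < 1"
  shows "ln (8 * q ^ 2 * real (k + 1) ^ 3) \<le> (ln (64 * q ^ 2) + 3) * log 2 (4 * real k / \<epsilon>)"
proof -
  define l where "l = log 2 (4 * real k / \<epsilon>)"
  have q2: "1 \<le> q ^ 2" using q by (rule one_le_power)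
  have "real k * \<epsilon> \<le> 4 * real k" using k eps by (simp add: mult.commute mult_mono)
  then have "real k \<le> 4 * real k / \<epsilon>" using eps by (simp add: field_simps)
  then have "log 2 (real k) \<le> l" unfolding l_def using k eps by (simp add: log_le_cancel_iff)
  moreover have "ln (real k) \<le> log 2 (real k)"
  proof -
    have "ln (2::real) \<le> 1" using ln_le_minus_one[of "2::real"] by simp
    then have "ln (real k) * ln 2 \<le> ln (real k) * 1" using k by (intro mult_left_mono) auto
    then show ?thesis by (simp add: log_def field_simps)
  qed
  ultimately have lk: "ln (real k) \<le> l" by linarith
  have "2 * \<epsilon> \<le> 4 * real k" using k eps by simp
  then have "2 \<le> 4 * real k / \<epsilon>" using eps by (simp add: field_simps)
  then have "log 2 2 \<le> l" unfolding l_def using k eps by (subst log_le_cancel_iff) auto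
  then have l1: "1 \<le> l" by simp
  \<comment> \<open>Bounding \<open>k + 1\<close> by \<open>2 * k\<close> costs a factor 8, whence
    \<open>64 = 8 * 8\<close>.\<close>
  have "real (k + 1) ^ 3 \<le> (2 * real k) ^ 3" using k by (intro power_mono) auto
  then have "8 * q ^ 2 * real (k + 1) ^ 3 \<le> 8 * q ^ 2 * (2 * real k) ^ 3"
    using q2 by (intro mult_left_mono) auto
  also have "\<dots> = (64 * q ^ 2) * real k ^ 3" by (simp add: power_mult_distrib)
  finally have "ln (8 * q ^ 2 * real (k + 1) ^ 3) \<le> ln ((64 * q ^ 2) * real k ^ 3)"
    using q k by (subst ln_le_cancel_iff) auto
  also have "\<dots> = ln (64 * q ^ 2) + 3 * ln (real k)"
    using q k by (simp add: ln_mult ln_realpow)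
  also have "\<dots> \<le> ln (64 * q ^ 2) * l + 3 * l"
    using mult_left_mono[OF l1, of "ln (64 * q ^ 2)"] lk q2 by (intro add_mono) auto
  finally show ?thesis by (simp add: l_def algebra_simps)
qed

theorem theorem1p5:
  "\<exists>c::real. \<forall>q::nat. (\<exists>p n. prime p \<and> n \<ge> 1 \<and> q = p ^ n) \<longrightarrow>
     (\<exists>Cq::real. \<forall>(R :: nat ring) (\<epsilon>::real) (k::nat) (m::nat)
         (r :: nat \<Rightarrow> nat) (P :: nat \<Rightarrow> (nat \<Rightarrow> nat) \<Rightarrow> bool) (idx :: nat \<Rightarrow> nat \<Rightarrow> nat).
        field R \<and> finite (carrier R) \<and> card (carrier R) = q \<and>
        0 < \<epsilon> \<and> \<epsilon> < 1 \<and> k \<ge> 1 \<and>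
        (\<forall>j<m. affine_pred R (r j) (P j) \<and> (\<forall>i<r j. idx j i < k))
        \<longrightarrow>
        (\<exists>T w. T \<subseteq> {..<m} \<and> (\<forall>j\<in>T. w j \<ge> (0::real)) \<and>
           real (card T) \<le> Cq * real k / \<epsilon>\<^sup>2 * (log 2 (4 * real k / \<epsilon>)) powr c \<and>
           (\<forall>x. (\<forall>i<k. x i \<in> carrier R) \<longrightarrow>
              (1 - \<epsilon>) * (\<Sum>j<m. constr_val R (r j) (P j) (idx j) x)
                \<le> (\<Sum>j\<in>T. w j * constr_val R (r j) (P j) (idx j) x) \<and>
              (\<Sum>j\<in>T. w j * constr_val R (r j) (P j) (idx j) x)
                \<le> (1 + \<epsilon>) * (\<Sum>j<m. constr_val R (r j) (P j) (idx j) x))))"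
proof (rule exI[of _ 1], intro allI impI)
  fix q :: nat
  assume "\<exists>p n. prime p \<and> n \<ge> 1 \<and> q = p ^ n"
  then have q: "1 \<le> real q" using prime_gt_0_nat by (auto simp: Suc_le_eq)
  show "\<exists>Cq::real. \<forall>(R :: nat ring) (\<epsilon>::real) (k::nat) (m::nat)
         (r :: nat \<Rightarrow> nat) (P :: nat \<Rightarrow> (nat \<Rightarrow> nat) \<Rightarrow> bool) (idx :: nat \<Rightarrow> nat \<Rightarrow> nat).
        field R \<and> finite (carrier R) \<and> card (carrier R) = q \<and>
        0 < \<epsilon> \<and> \<epsilon> < 1 \<and> k \<ge> 1 \<and>
        (\<forall>j<m. affine_pred R (r j) (P j) \<and> (\<forall>i<r j. idx j i < k))
        \<longrightarrow>
        (\<exists>T w. T \<subseteq> {..<m} \<and> (\<forall>j\<in>T. w j \<ge> (0::real)) \<and>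
           real (card T) \<le> Cq * real k / \<epsilon>\<^sup>2 * (log 2 (4 * real k / \<epsilon>)) powr 1 \<and>
           (\<forall>x. (\<forall>i<k. x i \<in> carrier R) \<longrightarrow>
              (1 - \<epsilon>) * (\<Sum>j<m. constr_val R (r j) (P j) (idx j) x)
                \<le> (\<Sum>j\<in>T. w j * constr_val R (r j) (P j) (idx j) x) \<and>
              (\<Sum>j\<in>T. w j * constr_val R (r j) (P j) (idx j) x)
                \<le> (1 + \<epsilon>) * (\<Sum>j<m. constr_val R (r j) (P j) (idx j) x)))"
  proof (intro exI[of _ "32 * (ln (64 * real q ^ 2) + 3)"] allI impI; elim conjE)
    fix R :: "nat ring" and \<epsilon> :: real and k m :: nat and r :: "nat \<Rightarrow> nat"
      and P :: "nat \<Rightarrow> (nat \<Rightarrow> nat) \<Rightarrow> bool" and idx :: "nat \<Rightarrow> nat \<Rightarrow> nat"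
    assume R: "field R" "finite (carrier R)" "card (carrier R) = q"
      and eps: "0 < \<epsilon>" "\<epsilon> < 1" and k: "k \<ge> 1"
      and P: "\<forall>j<m. affine_pred R (r j) (P j) \<and> (\<forall>i<r j. idx j i < k)"
    define l where "l = log 2 (4 * real k / \<epsilon>)"
    define K where "K = ln (64 * real q ^ 2) + 3"
    define val where "val j x = constr_val R (r j) (P j) (idx j) x" for j x
    obtain T w where T: "T \<subseteq> {..<m}" "\<forall>j\<in>T. 0 \<le> w j"
      and card: "real (card T) \<le> 16 * real (k + 1) * ln (8 * real q ^ 2 * real (k + 1) ^ 3) / \<epsilon>\<^sup>2"
      and dev: "\<forall>x. (\<forall>i<k. x i \<in> carrier R) \<longrightarrow>
        \<bar>(\<Sum>j\<in>T. w j * val j x) - (\<Sum>j<m. val j x)\<bar> \<le> \<epsilon> * (\<Sum>j<m. val j x)"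
      using affine_constraints_sparsifier[OF R(1,2) eps(1), where m = m and r = r and P = P and idx = idx and k = k]
        P eps(2) R(3) unfolding val_def by (auto simp: less_imp_le)
    have ln: "ln (8 * real q ^ 2 * real (k + 1) ^ 3) \<le> K * l"
      unfolding K_def l_def by (rule ln_size_bound[OF q k eps])
    have "1 \<le> real q ^ 2 * real (k + 1) ^ 3"
      using mult_mono[OF one_le_power[OF q, of 2] one_le_power[of "real (k + 1)" 3]] by simp
    then have ln0: "0 \<le> ln (8 * real q ^ 2 * real (k + 1) ^ 3)" by simp
    have "2 \<le> 4 * real k / \<epsilon>" using k eps by (simp add: field_simps)
    then have l: "0 < l" unfolding l_def by (intro zero_less_log_cancel_iff[THEN iffD2]) auto
    \<comment> \<open>The constant 32 in \<open>Cq\<close> comes from 16 and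
      \<open>k + 1 \<le> 2 * k\<close>.\<close>
    have "16 * real (k + 1) \<le> 32 * real k" using k by simp
    then have "16 * real (k + 1) * ln (8 * real q ^ 2 * real (k + 1) ^ 3) \<le> (32 * real k) * (K * l)"
      using mult_mono'[OF _ ln _ ln0] by simp
    then have "real (card T) \<le> (32 * real k) * (K * l) / \<epsilon>\<^sup>2"
      using card eps by (meson divide_right_mono order_trans zero_le_power2)
    \<comment> \<open>The size is linear in the logarithm, which is why \<open>c = 1\<close>
      suffices; positivity of \<open>l\<close> makes \<open>l powr 1\<close> equal to
      \<open>l\<close>.\<close>
    also have "\<dots> = 32 * K * real k / \<epsilon>\<^sup>2 * l powr 1" using l by simp
    finally have card': "real (card T) \<le> 32 * K * real k / \<epsilon>\<^sup>2 * l powr 1" .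
    have "(1 - \<epsilon>) * (\<Sum>j<m. val j x) \<le> (\<Sum>j\<in>T. w j * val j x) \<and>
        (\<Sum>j\<in>T. w j * val j x) \<le> (1 + \<epsilon>) * (\<Sum>j<m. val j x)" if "\<forall>i<k. x i \<in> carrier R" for x
      using dev[rule_format, of x] that by (simp add: abs_le_iff algebra_simps)
    then show "\<exists>T w. T \<subseteq> {..<m} \<and> (\<forall>j\<in>T. w j \<ge> (0::real)) \<and>
           real (card T) \<le> 32 * (ln (64 * real q ^ 2) + 3) * real k / \<epsilon>\<^sup>2 * (log 2 (4 * real k / \<epsilon>)) powr 1 \<and>
           (\<forall>x. (\<forall>i<k. x i \<in> carrier R) \<longrightarrow>
              (1 - \<epsilon>) * (\<Sum>j<m. constr_val R (r j) (P j) (idx j) x)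
                \<le> (\<Sum>j\<in>T. w j * constr_val R (r j) (P j) (idx j) x) \<and>
              (\<Sum>j\<in>T. w j * constr_val R (r j) (P j) (idx j) x)
                \<le> (1 + \<epsilon>) * (\<Sum>j<m. constr_val R (r j) (P j) (idx j) x))"
      using T card' unfolding val_def K_def l_def by blast
  qed
qed

end
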